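(* For each $k\ge 1$, the projective $k$-consistency algorithm, given as input a CSP instance $\mathbf{A},\mathbf{B}$: (1) runs in polynomial time; (2) outputs a CSP instance $\mathbf{A}',\mathbf{B}'$ that has the same satisfying assignments as $\mathbf{A},\mathbf{B}$; and (3) reports an inconsistency if and only if the Duplicator does not have a winning strategy in the existential $k$-cover game on $\mathbf{A},\mathbf{B}$.
   Context: A CSP instance is a pair $\mathbf{A},\mathbf{B}$ of finite relational structures over the same finite relational signature (universes $A$, $B$; relations $R^{\mathbf{A}}\subseteq A^r$, $R^{\mathbf{B}}\subseteq B^r$ for each symbol $R$ of arity $r$); a satisfying assignment is a homomorphism $h:A\to B$, i.e. $(h(a_1),\ldots,h(a_r))\in R^{\mathbf{B}}$ for every $(a_1,\ldots,a_r)\in R^{\mathbf{A}}$. The hypergraph $H(\mathbf{A})$ has vertex set $A$ and a hyperedge $\{a_1,\ldots,a_r\}$ for each tuple in any relation of $\mathbf{A}$; a $k$-union over $\mathbf{A}$ is a union of $k$ hyperedges (the empty set is the $0$-union); the weight of $X\subseteq A$ is the least $k\ge 0$ such that $X\cap\bigcup_e e$ lies in a $k$-union. A projective homomorphism from $\mathbf{A}$ to $\mathbf{B}$ is a partial function $h$ from $A$ to $B$ such that for every $R$ and $(a_1,\ldots,a_r)\in R^{\mathbf{A}}$ there is $(b_1,\ldots,b_r)\in R^{\mathbf{B}}$ with $h(a_i)=b_i$ for all $a_i\in\mathsf{dom}(h)$. A winning strategy for the Duplicator in the existential $k$-cover game on $\mathbf{A},\mathbf{B}$ is a non-empty set $H$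 of projective homomorphisms from $\mathbf{A}$ to $\mathbf{B}$, closed under subfunctions, such that for all $h\in H$ and $a\notin\mathsf{dom}(h)$ with $\mathsf{dom}(h)\cup\{a\}$ of weight $\le k$, some $h'\in H$ extends $h$ with domain $\mathsf{dom}(h)\cup\{a\}$. The projective $k$-consistency algorithm on input $\mathbf{A},\mathbf{B}$: build a new instance $\mathbf{A}',\mathbf{B}'$ with universes $A$ and $B$ and a new signature containing one relation symbol $R_U$ for each $k$-union $U$ over $\mathbf{A}$; $R_U^{\mathbf{A}'}$ consists of the single tuple $(u_1,\ldots,u_m)$ listing the elements of $U$ in some fixed order, and $R_U^{\mathbf{B}'}$ is the set of all $(b_1,\ldots,b_m)$ such that the map $u_i\mapsto b_i$ is a projective homomorphism from $\mathbf{A}$ to $\mathbf{B}$. Then repeatedly, until no change occurs, remove any tuple $(b_1,\ldots,b_m)\in R_U^{\mathbf{B}'}$ for which the map $u_i\mapsto b_i$ (with $(u_1,\ldots,u_m)$ the unique tuple of $R_U^{\mathbf{A}'}$) is not a projective homomorphism from $\mathbf{A}'$ to $\mathbf{B}'$. Finally, report an inconsistency if no $\mathbf{B}'$-tuples remain. The output instance is $\mathbf{A}',\mathbf{B}'$.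
   Formalization: Claim (3) is stated only when A has at least one non-empty tuple; if A has no tuples, there is no k-union, so an inconsistency is reported vacuously although the Duplicator wins (e.g. A={a}, B={b}, no tuples). *)

theory Defs
  imports "HOL-Library.FuncSet" "HOL-Computational_Algebra.Polynomial"
begin

section \<open>CSP instances\<close>

record 's rel_signature =
  symbols :: "'s set"
  arity :: "'s \<Rightarrow> nat"

record ('s, 'a) rel_struct =
  universe :: "'a set"
  rel :: "'s \<Rightarrow> 'a list set"

definition finite_structure :: "'s rel_signature \<Rightarrow> ('s, 'a) rel_struct \<Rightarrow> bool" where
  "finite_structure \<sigma> A \<longleftrightarrow> finite (universe A) \<and>
     (\<forall>R\<in>symbols \<sigma>. \<forall>as\<in>rel A R. length as = arity \<sigma> R \<and> set as \<subseteq> universe A)"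

definition csp_instance ::
  "'s rel_signature \<Rightarrow> ('s, 'a) rel_struct \<Rightarrow> ('s, 'b) rel_struct \<Rightarrow> bool" where
  "csp_instance \<sigma> A B \<longleftrightarrow>
     finite (symbols \<sigma>) \<and> finite_structure \<sigma> A \<and> finite_structure \<sigma> B"

definition satisfying_assignments ::
  "'s rel_signature \<Rightarrow> ('s, 'a) rel_struct \<Rightarrow> ('s, 'b) rel_struct \<Rightarrow> ('a \<Rightarrow> 'b) set" where
  "satisfying_assignments \<sigma> A B =
     {h \<in> universe A \<rightarrow>\<^sub>E universe B. \<forall>R\<in>symbols \<sigma>. \<forall>as\<in>rel A R. map h as \<in> rel B R}"


section \<open>Unions of hyperedges and the existential cover game\<close>

definition hyperedges :: "'s rel_signature \<Rightarrow> ('s, 'a) rel_struct \<Rightarrow> 'a set set" where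
  "hyperedges \<sigma> A = {set as | as R. R \<in> symbols \<sigma> \<and> as \<in> rel A R}"

text \<open>The \<open>k\<close> hyperedges need not be distinct, so an \<open>i\<close>-union with \<open>1 \<le> i \<le> k\<close> is
  also a \<open>k\<close>-union.\<close>

definition k_union :: "nat \<Rightarrow> 's rel_signature \<Rightarrow> ('s, 'a) rel_struct \<Rightarrow> 'a set \<Rightarrow> bool" where
  "k_union k \<sigma> A U \<longleftrightarrow> (\<exists>es. length es = k \<and> set es \<subseteq> hyperedges \<sigma> A \<and> U = \<Union>(set es))"

definition weight :: "'s rel_signature \<Rightarrow> ('s, 'a) rel_struct \<Rightarrow> 'a set \<Rightarrow> nat" where
  "weight \<sigma> A X = (LEAST k. \<exists>U. k_union k \<sigma> A U \<and> X \<inter> \<Union>(hyperedges \<sigma> A) \<subseteq> U)"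

definition projective_hom ::
  "'s rel_signature \<Rightarrow> ('s, 'a) rel_struct \<Rightarrow> ('s, 'b) rel_struct \<Rightarrow> ('a \<rightharpoonup> 'b) \<Rightarrow> bool" where
  "projective_hom \<sigma> A B h \<longleftrightarrow> dom h \<subseteq> universe A \<and> ran h \<subseteq> universe B \<and>
     (\<forall>R\<in>symbols \<sigma>. \<forall>as\<in>rel A R. \<exists>bs\<in>rel B R.
        \<forall>i<arity \<sigma> R. as ! i \<in> dom h \<longrightarrow> h (as ! i) = Some (bs ! i))"

definition winning_strategy ::
  "nat \<Rightarrow> 's rel_signature \<Rightarrow> ('s, 'a) rel_struct \<Rightarrow> ('s, 'b) rel_struct \<Rightarrow> ('a \<rightharpoonup> 'b) set \<Rightarrow> bool"
where
  "winning_strategy k \<sigma> A B H \<longleftrightarrow>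
     H \<noteq> {} \<and>
     (\<forall>h\<in>H. projective_hom \<sigma> A B h) \<and>
     (\<forall>h\<in>H. \<forall>g. g \<subseteq>\<^sub>m h \<longrightarrow> g \<in> H) \<and>
     (\<forall>h\<in>H. \<forall>a\<in>universe A. a \<notin> dom h \<longrightarrow> weight \<sigma> A (insert a (dom h)) \<le> k \<longrightarrow>
        (\<exists>h'\<in>H. h \<subseteq>\<^sub>m h' \<and> dom h' = insert a (dom h)))"


section \<open>The projective consistency algorithm\<close>

text \<open>The symbol \<open>R\<^sub>U\<close> of the new signature is the \<open>k\<close>-union \<open>U\<close> itself. The function
  \<open>ord\<close> fixes the order in which the elements of each \<open>k\<close>-union are listed.\<close>

definition listing ::
  "nat \<Rightarrow> 's rel_signature \<Rightarrow> ('s, 'a) rel_struct \<Rightarrow> ('a set \<Rightarrow> 'a list) \<Rightarrow> bool" where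
  "listing k \<sigma> A ord \<longleftrightarrow> (\<forall>U. k_union k \<sigma> A U \<longrightarrow> distinct (ord U) \<and> set (ord U) = U)"

definition union_signature ::
  "nat \<Rightarrow> 's rel_signature \<Rightarrow> ('s, 'a) rel_struct \<Rightarrow> 'a set rel_signature" where
  "union_signature k \<sigma> A = \<lparr>symbols = {U. k_union k \<sigma> A U}, arity = card\<rparr>"

definition union_source ::
  "nat \<Rightarrow> ('a set \<Rightarrow> 'a list) \<Rightarrow> 's rel_signature \<Rightarrow> ('s, 'a) rel_struct \<Rightarrow> ('a set, 'a) rel_struct"
where
  "union_source k ord \<sigma> A =
     \<lparr>universe = universe A, rel = (\<lambda>U. if k_union k \<sigma> A U then {ord U} else {})\<rparr>"

definition union_target ::
  "nat \<Rightarrow> ('a set \<Rightarrow> 'a list) \<Rightarrow> 's rel_signature \<Rightarrow> ('s, 'a) rel_struct \<Rightarrow> ('s, 'b) rel_struct \<Rightarrow>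
     ('a set, 'b) rel_struct"
where
  "union_target k ord \<sigma> A B =
     \<lparr>universe = universe B,
      rel = (\<lambda>U. {bs. k_union k \<sigma> A U \<and> length bs = length (ord U) \<and>
                      projective_hom \<sigma> A B (map_of (zip (ord U) bs))})\<rparr>"

definition removal ::
  "nat \<Rightarrow> ('a set \<Rightarrow> 'a list) \<Rightarrow> 's rel_signature \<Rightarrow> ('s, 'a) rel_struct \<Rightarrow>
     ('a set, 'b) rel_struct \<Rightarrow> ('a set, 'b) rel_struct \<Rightarrow> bool"
where
  "removal k ord \<sigma> A B1 B2 \<longleftrightarrow>
     (\<exists>U bs. k_union k \<sigma> A U \<and> bs \<in> rel B1 U \<and>
        \<not> projective_hom (union_signature k \<sigma> A) (union_source k ord \<sigma> A) B1
             (map_of (zip (ord U) bs)) \<and>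
        B2 = B1\<lparr>rel := (rel B1)(U := rel B1 U - {bs})\<rparr>)"

text \<open>An execution is recorded as the list of successive values of the target structure
  \<open>B'\<close>; the algorithm does not prescribe which tuple to remove next.\<close>

definition execution ::
  "nat \<Rightarrow> ('a set \<Rightarrow> 'a list) \<Rightarrow> 's rel_signature \<Rightarrow> ('s, 'a) rel_struct \<Rightarrow> ('s, 'b) rel_struct \<Rightarrow>
     ('a set, 'b) rel_struct list \<Rightarrow> bool"
where
  "execution k ord \<sigma> A B Bs \<longleftrightarrow>
     Bs \<noteq> [] \<and> hd Bs = union_target k ord \<sigma> A B \<and> successively (removal k ord \<sigma> A) Bs"

definition complete_execution ::
  "nat \<Rightarrow> ('a set \<Rightarrow> 'a list) \<Rightarrow> 's rel_signature \<Rightarrow> ('s, 'a) rel_struct \<Rightarrow> ('s, 'b) rel_struct \<Rightarrow>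
     ('a set, 'b) rel_struct list \<Rightarrow> bool"
where
  "complete_execution k ord \<sigma> A B Bs \<longleftrightarrow>
     execution k ord \<sigma> A B Bs \<and> (\<nexists>B'. removal k ord \<sigma> A (last Bs) B')"

text \<open>If \<open>A\<close> has no tuple at all, there is no \<open>k\<close>-union with \<open>k \<ge> 1\<close>, and an inconsistency
  is reported vacuously.\<close>

definition reports_inconsistency ::
  "nat \<Rightarrow> 's rel_signature \<Rightarrow> ('s, 'a) rel_struct \<Rightarrow> ('a set, 'b) rel_struct \<Rightarrow> bool" where
  "reports_inconsistency k \<sigma> A B' \<longleftrightarrow> (\<forall>U. k_union k \<sigma> A U \<longrightarrow> rel B' U = {})"


section \<open>A model of computation\<close>

text \<open>First-order call-by-value programs over binary trees, in the style of N. D. Jones's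
  WHILE and F languages (polynomial time for them is polynomial time on Turing machines, trees
  being stored as shared graphs). A program is a finite list of function bodies, function 0
  being the main one; every evaluated constructor, selector, test, parameter access and call
  costs one unit of time. There is no equality primitive: names of elements have to be compared
  by a program.\<close>

datatype tree = Leaf | Node tree tree

fun left :: "tree \<Rightarrow> tree" where
  "left Leaf = Leaf"
| "left (Node l r) = l"

fun right :: "tree \<Rightarrow> tree" where
  "right Leaf = Leaf"
| "right (Node l r) = r"

datatype exp =
    Param nat
  | MkLeaf
  | MkNode exp exp
  | Left exp
  | Right exp
  | IfNode exp exp exp
  | Call nat "exp list"

inductive eval :: "exp list \<Rightarrow> tree list \<Rightarrow> exp \<Rightarrow> tree \<Rightarrow> nat \<Rightarrow> bool"
  and evals :: "exp list \<Rightarrow> tree list \<Rightarrow> exp list \<Rightarrow> tree list \<Rightarrow> nat \<Rightarrow> bool"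
  for P where
  eval_Param: "i < length vs \<Longrightarrow> eval P vs (Param i) (vs ! i) 1"
| eval_MkLeaf: "eval P vs MkLeaf Leaf 1"
| eval_MkNode: "eval P vs e1 v1 t1 \<Longrightarrow> eval P vs e2 v2 t2 \<Longrightarrow>
    eval P vs (MkNode e1 e2) (Node v1 v2) (t1 + t2 + 1)"
| eval_Left: "eval P vs e v t \<Longrightarrow> eval P vs (Left e) (left v) (t + 1)"
| eval_Right: "eval P vs e v t \<Longrightarrow> eval P vs (Right e) (right v) (t + 1)"
| eval_IfNode_True: "eval P vs e (Node l r) t \<Longrightarrow> eval P vs e1 v t' \<Longrightarrow>
    eval P vs (IfNode e e1 e2) v (t + t' + 1)"
| eval_IfNode_False: "eval P vs e Leaf t \<Longrightarrow> eval P vs e2 v t' \<Longrightarrow>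
    eval P vs (IfNode e e1 e2) v (t + t' + 1)"
| eval_Call: "f < length P \<Longrightarrow> evals P vs es ws t \<Longrightarrow> eval P ws (P ! f) v t' \<Longrightarrow>
    eval P vs (Call f es) v (t + t' + 1)"
| evals_Nil: "evals P vs [] [] 0"
| evals_Cons: "eval P vs e v t \<Longrightarrow> evals P vs es ws t' \<Longrightarrow>
    evals P vs (e # es) (v # ws) (t + t')"

definition computes_in_time :: "exp list \<Rightarrow> tree \<Rightarrow> tree \<Rightarrow> nat \<Rightarrow> bool" where
  "computes_in_time P x y t \<longleftrightarrow> eval P [x] (Call 0 [Param 0]) y t"


section \<open>Encoding of instances and executions\<close>

text \<open>\<open>code :: 'x \<Rightarrow> tree \<Rightarrow> bool\<close> relates an object to the trees that encode it: a finite set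
  is encoded by any repetition-free enumeration of it.\<close>

fun tree_of_list :: "tree list \<Rightarrow> tree" where
  "tree_of_list [] = Leaf"
| "tree_of_list (t # ts) = Node t (tree_of_list ts)"

definition name_code :: "('x \<Rightarrow> tree) \<Rightarrow> 'x \<Rightarrow> tree \<Rightarrow> bool" where
  "name_code \<nu> x t \<longleftrightarrow> t = \<nu> x"

definition list_code :: "('x \<Rightarrow> tree \<Rightarrow> bool) \<Rightarrow> 'x list \<Rightarrow> tree \<Rightarrow> bool" where
  "list_code code xs t \<longleftrightarrow> (\<exists>ts. list_all2 code xs ts \<and> t = tree_of_list ts)"

definition set_code :: "('x \<Rightarrow> tree \<Rightarrow> bool) \<Rightarrow> 'x set \<Rightarrow> tree \<Rightarrow> bool" where
  "set_code code X t \<longleftrightarrow> (\<exists>xs. distinct xs \<and> set xs = X \<and> list_code code xs t)"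

definition unary :: "nat \<Rightarrow> tree" where
  "unary n = tree_of_list (replicate n Leaf)"

definition instance_code ::
  "('s \<Rightarrow> tree \<Rightarrow> bool) \<Rightarrow> ('a \<Rightarrow> tree \<Rightarrow> bool) \<Rightarrow> ('b \<Rightarrow> tree \<Rightarrow> bool) \<Rightarrow>
     's rel_signature \<Rightarrow> ('s, 'a) rel_struct \<Rightarrow> ('s, 'b) rel_struct \<Rightarrow> tree \<Rightarrow> bool"
where
  "instance_code codeS codeA codeB \<sigma> A B t \<longleftrightarrow>
     (\<exists>tA tB tR. set_code codeA (universe A) tA \<and> set_code codeB (universe B) tB \<and>
        set_code (\<lambda>R t. \<exists>n a b. codeS R n \<and> set_code (list_code codeA) (rel A R) a \<and>
                        set_code (list_code codeB) (rel B R) b \<and>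
                        t = tree_of_list [n, unary (arity \<sigma> R), a, b]) (symbols \<sigma>) tR \<and>
        t = tree_of_list [tA, tB, tR])"

text \<open>The code of an execution consists of the report and of the codes of all the successive
  instances \<open>A', B'\<close>, the last of which is the output. Asking for the whole execution, rather
  than for its result only, makes the running time that of the algorithm itself and not that of
  some other way of computing the same output.\<close>

definition execution_code ::
  "('a \<Rightarrow> tree) \<Rightarrow> ('b \<Rightarrow> tree) \<Rightarrow> nat \<Rightarrow> ('a set \<Rightarrow> 'a list) \<Rightarrow>
     's rel_signature \<Rightarrow> ('s, 'a) rel_struct \<Rightarrow> ('a set, 'b) rel_struct list \<Rightarrow> tree \<Rightarrow> bool"
where
  "execution_code \<alpha> \<beta> k ord \<sigma> A Bs t \<longleftrightarrow>
     (\<exists>report trace. t = Node report trace \<and>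
        (report \<noteq> Leaf \<longleftrightarrow> reports_inconsistency k \<sigma> A (last Bs)) \<and>
        list_code (instance_code (set_code (name_code \<alpha>)) (name_code \<alpha>) (name_code \<beta>)
                     (union_signature k \<sigma> A) (union_source k ord \<sigma> A)) Bs trace)"

text \<open>The bound is in the size of the input tree; the program and the bound depend on \<open>k\<close> only,
  not on the instance, the names of its symbols and elements, or the order of enumeration. The
  first conjunct bounds the number of rounds whatever tuples are chosen for removal.\<close>

definition runs_in_polynomial_time ::
  "'s itself \<Rightarrow> 'a itself \<Rightarrow> 'b itself \<Rightarrow> nat \<Rightarrow> bool" where
  "runs_in_polynomial_time S_TYPE A_TYPE B_TYPE k \<longleftrightarrow>
     (\<exists>(P :: exp list) (p :: nat poly).
        \<forall>(\<sigma> :: 's rel_signature) (A :: ('s, 'a) rel_struct) (B :: ('s, 'b) rel_struct) \<gamma> \<alpha> \<beta> x.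
          csp_instance \<sigma> A B \<and>
          inj_on \<gamma> (symbols \<sigma>) \<and> inj_on \<alpha> (universe A) \<and> inj_on \<beta> (universe B) \<and>
          instance_code (name_code \<gamma>) (name_code \<alpha>) (name_code \<beta>) \<sigma> A B x \<longrightarrow>
          (\<forall>ord Bs. listing k \<sigma> A ord \<and> execution k ord \<sigma> A B Bs \<longrightarrow> length Bs \<le> poly p (size x)) \<and>
          (\<exists>ord Bs y t. listing k \<sigma> A ord \<and> complete_execution k ord \<sigma> A B Bs \<and>
             execution_code \<alpha> \<beta> k ord \<sigma> A Bs y \<and>
             computes_in_time P x y t \<and> t \<le> poly p (size x)))"

end

theory Submission
  imports Defs "HOL-Library.Sublist"
begin

text \<open>A tuple of \<open>R\<^sub>U\<close> is a projective homomorphism with domain \<open>U\<close>. The tuples given by the maps of a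
  winning strategy are never removed, because such a map extends, within the strategy, from
  \<open>U \<inter> V\<close> to every other union \<open>V\<close>; conversely the maps below surviving tuples form a winning
  strategy. Satisfying assignments survive for the same reason.

  A projective homomorphism whose domain is the union of \<open>k\<close> hyperedges is determined by one
  tuple of \<open>B\<close> for each of these hyperedges. Hence the lists obtained by concatenating \<open>k\<close> pairings
  of a tuple of \<open>A\<close> with one of \<open>B\<close> enumerate all candidates; their number, polynomial for fixed
  \<open>k\<close>, bounds the number of removals, and serves the program as the length of its main loop. The
  test of a tuple against \<open>A, B\<close> and its test against \<open>A', B'\<close> are the same function of a list of
  constraints.\<close>

section \<open>Functions on trees computable in polynomial time\<close>

text \<open>The model of computation is handled through closure properties of a class of tree
  functions, so that the algorithm can be written as ordinary functions on lists; only equality and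
  iteration need recursive programs. The obstacle is iteration: a polynomial-time step repeated
  polynomially often may let its accumulator grow exponentially, so closure under folds demands a
  bound on all intermediate values. The main loop records its whole history, and this stays small
  because deletion never enlarges a state.

  The algorithm leaves open the order of removals and the listing of the unions. Facts about the
  output are therefore proved as invariants of the removal relation, valid for every execution,
  whereas the program realizes one execution, with a listing dictated by the order in which its
  input is enumerated.\<close>

fun shift :: "nat \<Rightarrow> exp \<Rightarrow> exp" where
  "shift n (Param i) = Param i"
| "shift n MkLeaf = MkLeaf"
| "shift n (MkNode a b) = MkNode (shift n a) (shift n b)"
| "shift n (Left a) = Left (shift n a)"
| "shift n (Right a) = Right (shift n a)"
| "shift n (IfNode a b c) = IfNode (shift n a) (shift n b) (shift n c)"
| "shift n (Call f es) = Call (f + n) (map (shift n) es)"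

text \<open>Linking of programs: calls are absolute indices, so code placed behind \<open>Q\<close>
  must have its indices moved by \<open>length Q\<close>, while code appended at the end disturbs
  nothing.\<close>

lemma eval_shift:
  "eval P vs e v t \<Longrightarrow>
    eval (Q @ map (shift (length Q)) P @ R) vs (shift (length Q) e) v t"
  "evals P vs es ws t \<Longrightarrow>
    evals (Q @ map (shift (length Q)) P @ R) vs (map (shift (length Q)) es) ws t"
proof (induction rule: eval_evals.inducts)
  case (eval_Call f vs es ws t v t')
  have "(Q @ map (shift (length Q)) P @ R) ! (f + length Q) = shift (length Q) (P ! f)"
    using eval_Call(1) by (simp add: nth_append)
  then have "eval (Q @ map (shift (length Q)) P @ R) vs
      (Call (f + length Q) (map (shift (length Q)) es)) v (t + t' + 1)"
    using eval_Call by (intro eval_evals.eval_Call) auto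
  then show ?case by simp
qed (use eval_evals.intros in \<open>force+\<close>)

lemma shift_0 [simp]: "shift 0 e = e"
proof (induction e)
  case (Call f es)
  then show ?case by (simp add: map_idI)
qed auto

lemma eval_append: "eval P vs e v t \<Longrightarrow> eval (P @ R) vs e v t"
  using eval_shift(1)[where Q = "[]" and R = R] by (simp add: map_idI)

text \<open>Natural coefficients make polynomials monotone, which is what allows bounds to be
  composed.\<close>

lemma poly_nat_mono: "m \<le> n \<Longrightarrow> poly (p :: nat poly) m \<le> poly p n"
  by (induction p) (auto intro!: mult_le_mono)

text \<open>Sharing makes \<open>MkNode\<close> double the size of a tree at unit cost, so that a polynomial bound
  on the size of the value has to be required in addition to the one on the time.\<close>

definition fpt :: "(tree \<Rightarrow> tree) \<Rightarrow> bool" where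
  "fpt f \<longleftrightarrow> (\<exists>P e p. \<forall>x. size (f x) \<le> poly p (size x) \<and>
     (\<exists>t \<le> poly p (size x). eval P [x] e (f x) t))"

definition realizes :: "exp list \<Rightarrow> exp \<Rightarrow> nat poly \<Rightarrow> (tree \<Rightarrow> tree) \<Rightarrow> bool" where
  "realizes P e p f \<longleftrightarrow> (\<forall>x. size (f x) \<le> poly p (size x) \<and>
     (\<exists>t \<le> poly p (size x). eval P [x] e (f x) t))"

lemma fpt_iff: "fpt f \<longleftrightarrow> (\<exists>P e p. realizes P e p f)"
  by (simp add: fpt_def realizes_def)

lemma fptI: "realizes P e p f \<Longrightarrow> fpt f"
  using fpt_iff by blast

lemma realizes_append: "realizes P e p f \<Longrightarrow> realizes (P @ R) e p f"
  unfolding realizes_def by (meson eval_append)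

lemma realizes_shift:
  "realizes P e p f \<Longrightarrow> realizes (Q @ map (shift (length Q)) P) (shift (length Q) e) p f"
  unfolding realizes_def using eval_shift(1)[where Q = Q and R = "[]"] by simp meson

lemma realizes_size: "realizes P e p f \<Longrightarrow> size (f x) \<le> poly p (size x)"
  by (simp add: realizes_def)

lemma realizes_eval:
  assumes "realizes P e p f"
  obtains t where "t \<le> poly p (size x)" "eval P [x] e (f x) t"
  using assms unfolding realizes_def by blast

text \<open>The second program is relocated behind the first, so that closure proofs may work with a
  single function table.\<close>

lemma fpt_common2:
  assumes "fpt f" "fpt g"
  obtains P e1 p1 e2 p2 where "realizes P e1 p1 f" "realizes P e2 p2 g"
  using assms realizes_append realizes_shift unfolding fpt_iff by metis

lemma fpt_common3:
  assumes "fpt f" "fpt g" "fpt h"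
  obtains P e1 p1 e2 p2 e3 p3
    where "realizes P e1 p1 f" "realizes P e2 p2 g" "realizes P e3 p3 h"
proof -
  obtain P e1 p1 e2 p2 where "realizes P e1 p1 f" "realizes P e2 p2 g"
    using fpt_common2 assms by metis
  moreover obtain Q e3 p3 where "realizes Q e3 p3 h"
    using assms fpt_iff by blast
  ultimately show thesis
    using realizes_append realizes_shift that by metis
qed

lemma fpt_size:
  assumes "fpt f"
  obtains p where "\<And>x. size (f x) \<le> poly p (size x)"
  using assms realizes_size unfolding fpt_iff by metis

section \<open>Basic closure properties\<close>

named_theorems fpt_intros

lemma fpt_id [fpt_intros]: "fpt (\<lambda>x. x)"
proof -
  have "realizes [] (Param 0) [:1, 1:] (\<lambda>x. x)"
    unfolding realizes_def
  proof (intro allI conjI)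
    fix x
    have "eval [] [x] (Param 0) ([x] ! 0) 1"
      by (rule eval_Param) simp
    then show "\<exists>t\<le>poly [:1, 1:] (size x). eval [] [x] (Param 0) x t"
      by auto
  qed auto
  then show ?thesis by (rule fptI)
qed

lemma fpt_Leaf [fpt_intros]: "fpt (\<lambda>x. Leaf)"
proof -
  have "realizes [] MkLeaf [:1:] (\<lambda>x. Leaf)"
    unfolding realizes_def using eval_MkLeaf by auto
  then show ?thesis by (rule fptI)
qed

lemma fpt_Node [fpt_intros]:
  assumes "fpt f" "fpt g"
  shows "fpt (\<lambda>x. Node (f x) (g x))"
proof -
  obtain P e1 p1 e2 p2 where *: "realizes P e1 p1 f" "realizes P e2 p2 g"
    using fpt_common2 assms by metis
  have "realizes P (MkNode e1 e2) (p1 + p2 + 1) (\<lambda>x. Node (f x) (g x))"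
    unfolding realizes_def
  proof (intro allI conjI)
    fix x
    show "size (Node (f x) (g x)) \<le> poly (p1 + p2 + 1) (size x)"
      using *[THEN realizes_size, of x] by simp
    obtain t1 t2 where "t1 \<le> poly p1 (size x)" "eval P [x] e1 (f x) t1"
      "t2 \<le> poly p2 (size x)" "eval P [x] e2 (g x) t2"
      using * realizes_eval by metis
    then show "\<exists>t\<le>poly (p1 + p2 + 1) (size x). eval P [x] (MkNode e1 e2) (Node (f x) (g x)) t"
      by (intro exI[of _ "t1 + t2 + 1"]) (auto intro: eval_MkNode[simplified])
  qed
  then show ?thesis by (rule fptI)
qed

lemma size_left_le: "size (left t) \<le> size t"
  by (cases t) auto

lemma size_right_le: "size (right t) \<le> size t"
  by (cases t) auto

lemma fpt_left [fpt_intros]: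
  assumes "fpt f"
  shows "fpt (\<lambda>x. left (f x))"
proof -
  obtain P e p where *: "realizes P e p f"
    using assms fpt_iff by blast
  have "realizes P (Left e) (p + 1) (\<lambda>x. left (f x))"
    unfolding realizes_def
  proof (intro allI conjI)
    fix x
    show "size (left (f x)) \<le> poly (p + 1) (size x)"
      using realizes_size[OF *, of x] size_left_le[of "f x"] by simp
    obtain t where "t \<le> poly p (size x)" "eval P [x] e (f x) t"
      using * realizes_eval by metis
    then show "\<exists>t\<le>poly (p + 1) (size x). eval P [x] (Left e) (left (f x)) t"
      by (intro exI[of _ "t + 1"]) (auto intro: eval_Left[simplified])
  qed
  then show ?thesis by (rule fptI)
qed

lemma fpt_right [fpt_intros]:
  assumes "fpt f"
  shows "fpt (\<lambda>x. right (f x))"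
proof -
  obtain P e p where *: "realizes P e p f"
    using assms fpt_iff by blast
  have "realizes P (Right e) (p + 1) (\<lambda>x. right (f x))"
    unfolding realizes_def
  proof (intro allI conjI)
    fix x
    show "size (right (f x)) \<le> poly (p + 1) (size x)"
      using realizes_size[OF *, of x] size_right_le[of "f x"] by simp
    obtain t where "t \<le> poly p (size x)" "eval P [x] e (f x) t"
      using * realizes_eval by metis
    then show "\<exists>t\<le>poly (p + 1) (size x). eval P [x] (Right e) (right (f x)) t"
      by (intro exI[of _ "t + 1"]) (auto intro: eval_Right[simplified])
  qed
  then show ?thesis by (rule fptI)
qed

text \<open>Expressions have no local binding, so the outer body is stored as a new function at
  index \<open>length P\<close> and called. Its input has size up to \<open>p2\<close>, whence
  \<open>pcompose p1 p2\<close>.\<close>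

lemma fpt_comp:
  assumes "fpt f" "fpt g"
  shows "fpt (\<lambda>x. f (g x))"
proof -
  obtain P e1 p1 e2 p2 where *: "realizes P e1 p1 f" "realizes P e2 p2 g"
    using fpt_common2 assms by metis
  define R where "R = P @ [e1]"
  have R: "realizes R e1 p1 f" "realizes R e2 p2 g"
    using * realizes_append R_def by metis+
  have "realizes R (Call (length P) [e2]) (pcompose p1 p2 + p2 + 1) (\<lambda>x. f (g x))"
    unfolding realizes_def
  proof (intro allI conjI)
    fix x
    have g: "size (g x) \<le> poly p2 (size x)"
      using realizes_size[OF R(2)] .
    have mono: "poly p1 (size (g x)) \<le> poly p1 (poly p2 (size x))"
      using g by (rule poly_nat_mono)
    show "size (f (g x)) \<le> poly (pcompose p1 p2 + p2 + 1) (size x)"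
      using realizes_size[OF R(1), of "g x"] mono by (simp add: poly_pcompose)
    obtain t1 t2 where t: "t1 \<le> poly p1 (size (g x))" "eval R [g x] e1 (f (g x)) t1"
      "t2 \<le> poly p2 (size x)" "eval R [x] e2 (g x) t2"
      using R realizes_eval by metis
    have "evals R [x] [e2] [g x] (t2 + 0)"
      by (intro evals_Cons evals_Nil t)
    moreover have "R ! length P = e1" "length P < length R"
      by (simp_all add: R_def)
    ultimately have "eval R [x] (Call (length P) [e2]) (f (g x)) (t2 + 0 + t1 + 1)"
      using t by (intro eval_Call) auto
    moreover have "t2 + 0 + t1 + 1 \<le> poly (pcompose p1 p2 + p2 + 1) (size x)"
      using t mono by (simp add: poly_pcompose)
    ultimately show "\<exists>t\<le>poly (pcompose p1 p2 + p2 + 1) (size x).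
        eval R [x] (Call (length P) [e2]) (f (g x)) t"
      by blast
  qed
  then show ?thesis by (rule fptI)
qed

text \<open>Several arguments are packed into one tree with \<open>Node\<close>. Hypotheses of the
  form \<open>fpt (\<lambda>z. f (left z) (right z))\<close> express throughout that
  \<open>f\<close> is computable jointly in its arguments.\<close>

lemma fpt_comp2:
  "fpt (\<lambda>z. f (left z) (right z)) \<Longrightarrow> fpt g \<Longrightarrow> fpt h \<Longrightarrow> fpt (\<lambda>x. f (g x) (h x))"
  using fpt_comp[of "\<lambda>z. f (left z) (right z)" "\<lambda>x. Node (g x) (h x)"] fpt_Node by simp

lemma fpt_if_Leaf:
  assumes "fpt c" "fpt f" "fpt g"
  shows "fpt (\<lambda>x. if c x = Leaf then g x else f x)"
proof -
  obtain P e1 p1 e2 p2 e3 p3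
    where *: "realizes P e1 p1 c" "realizes P e2 p2 f" "realizes P e3 p3 g"
    using fpt_common3 assms by metis
  have "realizes P (IfNode e1 e2 e3) (p1 + p2 + p3 + 1) (\<lambda>x. if c x = Leaf then g x else f x)"
    unfolding realizes_def
  proof (intro allI conjI)
    fix x
    show "size (if c x = Leaf then g x else f x) \<le> poly (p1 + p2 + p3 + 1) (size x)"
      using *[THEN realizes_size, of x] by simp
    obtain t1 t2 t3 where t: "t1 \<le> poly p1 (size x)" "eval P [x] e1 (c x) t1"
      "t2 \<le> poly p2 (size x)" "eval P [x] e2 (f x) t2"
      "t3 \<le> poly p3 (size x)" "eval P [x] e3 (g x) t3"
      using * realizes_eval by metis
    show "\<exists>t\<le>poly (p1 + p2 + p3 + 1) (size x).
        eval P [x] (IfNode e1 e2 e3) (if c x = Leaf then g x else f x) t"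
    proof (cases "c x")
      case Leaf
      then have "eval P [x] (IfNode e1 e2 e3) (g x) (t1 + t3 + 1)"
        using t by (intro eval_IfNode_False) auto
      then show ?thesis
        using t Leaf by (intro exI[of _ "t1 + t3 + 1"]) auto
    next
      case (Node l r)
      then have "eval P [x] (IfNode e1 e2 e3) (f x) (t1 + t2 + 1)"
        using t by (intro eval_IfNode_True) auto
      then show ?thesis
        using t Node by (intro exI[of _ "t1 + t2 + 1"]) auto
    qed
  qed
  then show ?thesis by (rule fptI)
qed

definition tree_of_bool :: "bool \<Rightarrow> tree" where
  "tree_of_bool b = (if b then Node Leaf Leaf else Leaf)"

definition fptb :: "(tree \<Rightarrow> bool) \<Rightarrow> bool" where
  "fptb c \<longleftrightarrow> fpt (\<lambda>x. tree_of_bool (c x))"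

lemma fpt_tree_of_bool [fpt_intros]: "fptb c \<Longrightarrow> fpt (\<lambda>x. tree_of_bool (c x))"
  by (simp add: fptb_def)

lemma tree_of_bool_eq_Leaf [simp]: "tree_of_bool b = Leaf \<longleftrightarrow> \<not> b"
  by (simp add: tree_of_bool_def)

lemma if_not: "(if \<not> b then x else y) = (if b then y else x)"
  by simp

lemma fpt_if [fpt_intros]:
  "fptb c \<Longrightarrow> fpt f \<Longrightarrow> fpt g \<Longrightarrow> fpt (\<lambda>x. if c x then f x else g x)"
  using fpt_if_Leaf[of "\<lambda>x. tree_of_bool (c x)" f g]
  unfolding fptb_def tree_of_bool_eq_Leaf
  by (simp only: if_not)

lemma fptb_eq_Leaf: "fpt f \<Longrightarrow> fptb (\<lambda>x. f x = Leaf)"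
  unfolding fptb_def tree_of_bool_def by (intro fpt_if_Leaf fpt_intros)

lemma fptb_True [fpt_intros]: "fptb (\<lambda>x. True)"
  unfolding fptb_def tree_of_bool_def by (simp add: fpt_intros)

lemma fptb_not [fpt_intros]: "fptb c \<Longrightarrow> fptb (\<lambda>x. \<not> c x)"
  using fptb_eq_Leaf[of "\<lambda>x. tree_of_bool (c x)"] by (simp add: fptb_def)

lemma fptb_if: "fptb c \<Longrightarrow> fptb d \<Longrightarrow> fptb e \<Longrightarrow> fptb (\<lambda>x. if c x then d x else e x)"
  using fpt_if[of c "\<lambda>x. tree_of_bool (d x)" "\<lambda>x. tree_of_bool (e x)"]
  by (simp add: fptb_def if_distrib[of tree_of_bool])

lemma fptb_conj [fpt_intros]: "fptb c \<Longrightarrow> fptb d \<Longrightarrow> fptb (\<lambda>x. c x \<and> d x)"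
proof -
  assume *: "fptb c" "fptb d"
  have "fptb (\<lambda>x. if c x then d x else \<not> True)"
    by (intro fptb_if fptb_not fptb_True *)
  moreover have "(\<lambda>x. if c x then d x else \<not> True) = (\<lambda>x. c x \<and> d x)"
    by auto
  ultimately show ?thesis by (simp only:)
qed

lemma fptb_imp [fpt_intros]: "fptb c \<Longrightarrow> fptb d \<Longrightarrow> fptb (\<lambda>x. c x \<longrightarrow> d x)"
proof -
  assume *: "fptb c" "fptb d"
  have "fptb (\<lambda>x. if c x then d x else True)"
    by (intro fptb_if fptb_True *)
  moreover have "(\<lambda>x. if c x then d x else True) = (\<lambda>x. c x \<longrightarrow> d x)"
    by auto
  ultimately show ?thesis by (simp only:)
qed

lemma fptb_comp: "fptb c \<Longrightarrow> fpt f \<Longrightarrow> fptb (\<lambda>x. c (f x))"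
  unfolding fptb_def by (rule fpt_comp)

section \<open>Equality of trees\<close>

definition eq_body :: exp where
  "eq_body =
    IfNode (Param 0)
      (IfNode (Param 1)
        (IfNode (Call 0 [Left (Param 0), Left (Param 1)])
          (Call 0 [Right (Param 0), Right (Param 1)]) MkLeaf)
        MkLeaf)
      (IfNode (Param 1) MkLeaf (MkNode MkLeaf MkLeaf))"

lemma eval_Param0: "eval P (v # vs) (Param 0) v 1"
  using eval_Param[of 0 "v # vs"] by simp

lemma eval_Param1: "eval P (u # v # vs) (Param 1) v 1"
  using eval_Param[of 1 "u # v # vs"] by simp

lemma eval_Param2: "eval P (u # v # w # vs) (Param 2) w 1"
  using eval_Param[of 2 "u # v # w # vs"] by simp

text \<open>The recursive calls act on disjoint subtrees of \<open>a\<close>, so the time is linear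
  in \<open>size a\<close> whatever the size of \<open>b\<close>. A node costs at most 15 units
  besides its two calls; the slope 40 leaves room for these and for the second additive constant
  10.\<close>

lemma eval_eq_body:
  "\<exists>t \<le> 40 * size a + 10. eval [eq_body] [a, b] eq_body (tree_of_bool (a = b)) t"
proof (induction a arbitrary: b)
  case Leaf
  show ?case
  proof (cases b)
    case L: Leaf
    have "eval [eq_body] [Leaf, b] eq_body (Node Leaf Leaf) (1 + (1 + (1 + 1 + 1) + 1) + 1)"
      unfolding eq_body_def L
      by (intro eval_IfNode_False eval_Param0 eval_Param1 eval_MkNode eval_MkLeaf)
    then show ?thesis using L by (intro exI conjI) (auto simp: tree_of_bool_def)
  next
    case (Node l r)
    have "eval [eq_body] [Leaf, b] eq_body Leaf (1 + (1 + 1 + 1) + 1)"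
      unfolding eq_body_def Node
      by (rule eval_IfNode_False[OF eval_Param0], rule eval_IfNode_True[OF eval_Param1],
          rule eval_MkLeaf)
    then show ?thesis using Node by (intro exI conjI) (auto simp: tree_of_bool_def)
  qed
next
  case (Node l r)
  show ?case
  proof (cases b)
    case L: Leaf
    have "eval [eq_body] [Node l r, b] eq_body Leaf (1 + (1 + 1 + 1) + 1)"
      unfolding eq_body_def L
      by (rule eval_IfNode_True[OF eval_Param0], rule eval_IfNode_False[OF eval_Param1],
          rule eval_MkLeaf)
    then show ?thesis using L by (intro exI conjI) (auto simp: tree_of_bool_def)
  next
    case b: (Node l' r')
    let ?P = "[eq_body]"
    let ?vs = "[Node l r, Node l' r']"
    obtain t1 where t1: "t1 \<le> 40 * size l + 10"
      "eval ?P [l, l'] eq_body (tree_of_bool (l = l')) t1"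
      using Node.IH(1) by blast
    obtain t2 where t2: "t2 \<le> 40 * size r + 10"
      "eval ?P [r, r'] eq_body (tree_of_bool (r = r')) t2"
      using Node.IH(2) by blast
    have "evals ?P ?vs [Left (Param 0), Left (Param 1)] [left (Node l r), left (Node l' r')] ((1+1) + ((1+1) + 0))"
      by (intro evals_Cons evals_Nil eval_Left eval_Param0 eval_Param1)
    then have c1: "eval ?P ?vs (Call 0 [Left (Param 0), Left (Param 1)]) (tree_of_bool (l = l'))
        (((1+1) + ((1+1) + 0)) + t1 + 1)"
      using t1 by (intro eval_Call) (simp_all add: b)
    have "evals ?P ?vs [Right (Param 0), Right (Param 1)] [right (Node l r), right (Node l' r')] ((1+1) + ((1+1) + 0))"
      by (intro evals_Cons evals_Nil eval_Right eval_Param0 eval_Param1)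
    then have c2: "eval ?P ?vs (Call 0 [Right (Param 0), Right (Param 1)]) (tree_of_bool (r = r'))
        (((1+1) + ((1+1) + 0)) + t2 + 1)"
      using t2 by (intro eval_Call) (simp_all add: b)
    show ?thesis
    proof (cases "l = l'")
      case True
      have c1': "eval ?P ?vs (Call 0 [Left (Param 0), Left (Param 1)]) (Node Leaf Leaf)
          (((1+1) + ((1+1) + 0)) + t1 + 1)"
        using c1 True by (simp add: tree_of_bool_def)
      have "eval ?P ?vs eq_body (tree_of_bool (r = r'))
          (1 + (1 + ((((1+1) + ((1+1) + 0)) + t1 + 1) + (((1+1) + ((1+1) + 0)) + t2 + 1) + 1) + 1) + 1)"
        using eval_IfNode_True[OF eval_Param0
            eval_IfNode_True[OF eval_Param1
              eval_IfNode_True[OF c1' c2]]]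
        unfolding eq_body_def by blast
      then show ?thesis
        using b True t1(1) t2(1) by (intro exI conjI) auto
    next
      case False
      have c1': "eval ?P ?vs (Call 0 [Left (Param 0), Left (Param 1)]) Leaf
          (((1+1) + ((1+1) + 0)) + t1 + 1)"
        using c1 False by (simp add: tree_of_bool_def)
      have "eval ?P ?vs eq_body Leaf
          (1 + (1 + ((((1+1) + ((1+1) + 0)) + t1 + 1) + 1 + 1) + 1) + 1)"
        using eval_IfNode_True[OF eval_Param0
            eval_IfNode_True[OF eval_Param1
              eval_IfNode_False[OF c1' eval_MkLeaf]]]
        unfolding eq_body_def by blast
      then show ?thesis
        using b False t1(1) by (intro exI conjI) (auto simp: tree_of_bool_def)
    qed
  qed
qed

lemma fptb_eq [fpt_intros]:
  assumes "fpt f" "fpt g"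
  shows "fptb (\<lambda>x. f x = g x)"
proof -
  let ?p = "[:25, 40:] :: nat poly"
  have "realizes [eq_body] (Call 0 [Left (Param 0), Right (Param 0)]) ?p
      (\<lambda>z. tree_of_bool (left z = right z))"
    unfolding realizes_def
  proof (intro allI conjI)
    fix z
    show "size (tree_of_bool (left z = right z)) \<le> poly ?p (size z)"
      by (simp add: tree_of_bool_def)
    obtain t where t: "t \<le> 40 * size (left z) + 10"
      "eval [eq_body] [left z, right z] eq_body (tree_of_bool (left z = right z)) t"
      using eval_eq_body by blast
    have "evals [eq_body] [z] [Left (Param 0), Right (Param 0)] [left z, right z] ((1+1) + ((1+1) + 0))"
      by (intro evals_Cons evals_Nil eval_Left eval_Right eval_Param0)
    then have "eval [eq_body] [z] (Call 0 [Left (Param 0), Right (Param 0)])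
        (tree_of_bool (left z = right z)) (((1+1) + ((1+1) + 0)) + t + 1)"
      using t by (intro eval_Call) auto
    moreover have "((1+1) + ((1+1) + 0)) + t + 1 \<le> poly ?p (size z)"
      using t(1) size_left_le[of z] by simp
    ultimately show "\<exists>t\<le>poly ?p (size z).
        eval [eq_body] [z] (Call 0 [Left (Param 0), Right (Param 0)]) (tree_of_bool (left z = right z)) t"
      by blast
  qed
  then have "fpt (\<lambda>z. tree_of_bool (left z = right z))" by (rule fptI)
  from fpt_comp2[OF this assms] show ?thesis
    by (simp add: fptb_def)
qed

subsection \<open>Lists\<close>

fun list_of_tree :: "tree \<Rightarrow> tree list" where
  "list_of_tree Leaf = []"
| "list_of_tree (Node h t) = h # list_of_tree t"

lemma list_of_tree_of_list [simp]: "list_of_tree (tree_of_list ts) = ts"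
  by (induction ts) auto

lemma tree_of_list_of_tree [simp]: "tree_of_list (list_of_tree t) = t"
  by (induction t) auto

lemma tree_of_list_eq_iff [simp]: "tree_of_list xs = tree_of_list ys \<longleftrightarrow> xs = ys"
  by (metis list_of_tree_of_list)

lemma tree_of_list_eq_Leaf [simp]: "tree_of_list xs = Leaf \<longleftrightarrow> xs = []"
  by (cases xs) auto

lemma size_tree_of_list_append [simp]:
  "size (tree_of_list (xs @ ys)) = size (tree_of_list xs) + size (tree_of_list ys)"
  by (induction xs) auto

lemma length_le_size: "length xs \<le> size (tree_of_list xs)"
  by (induction xs) auto

lemma size_tree_of_list_member: "x \<in> set xs \<Longrightarrow> size x \<le> size (tree_of_list xs)"
  by (induction xs) auto

definition fptl :: "(tree \<Rightarrow> tree list) \<Rightarrow> bool" where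
  "fptl l \<longleftrightarrow> fpt (\<lambda>x. tree_of_list (l x))"

lemma fpt_tree_of_list [fpt_intros]: "fptl l \<Longrightarrow> fpt (\<lambda>x. tree_of_list (l x))"
  by (simp add: fptl_def)

lemma fptl_list_of_tree [fpt_intros]: "fpt f \<Longrightarrow> fptl (\<lambda>x. list_of_tree (f x))"
  by (simp add: fptl_def)

lemma fptl_comp: "fptl l \<Longrightarrow> fpt f \<Longrightarrow> fptl (\<lambda>x. l (f x))"
  unfolding fptl_def by (rule fpt_comp)

lemma fptl_Nil [fpt_intros]: "fptl (\<lambda>x. [])"
  by (simp add: fptl_def fpt_Leaf)

lemma fptl_Cons [fpt_intros]: "fpt f \<Longrightarrow> fptl l \<Longrightarrow> fptl (\<lambda>x. f x # l x)"
  by (simp add: fptl_def fpt_Node)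

lemma fptl_if [fpt_intros]:
  "fptb c \<Longrightarrow> fptl f \<Longrightarrow> fptl g \<Longrightarrow> fptl (\<lambda>x. if c x then f x else g x)"
  using fpt_if[of c "\<lambda>x. tree_of_list (f x)" "\<lambda>x. tree_of_list (g x)"]
  by (simp add: fptl_def if_distrib[of tree_of_list])

section \<open>Iteration over a list\<close>

text \<open>The parameters are the environment, the rest of the list and the accumulator.\<close>

definition fold_body :: exp where
  "fold_body =
    IfNode (Param 1)
      (Call 0 [Param 0, Right (Param 1),
        Call 1 [MkNode (Param 0) (MkNode (Param 2) (Left (Param 1)))]])
      (Param 2)"

text \<open>The bound \<open>M\<close> is required for every prefix because each step runs on the
  accumulator reached so far. A round costs at most \<open>K\<close> for the step plus 13 units of
  overhead, within the 15 allowed.\<close>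

lemma eval_fold_body:
  assumes G: "\<And>acc h. size acc \<le> M \<Longrightarrow> size h \<le> N \<Longrightarrow>
      \<exists>t \<le> K. eval P [Node x (Node acc h)] (P ! 1) (G acc h) t"
    and P: "P ! 0 = fold_body" "1 < length P"
  shows "(\<And>ys. prefix ys (list_of_tree l) \<Longrightarrow> size (foldl G acc ys) \<le> M) \<Longrightarrow> size l \<le> N \<Longrightarrow>
    \<exists>t \<le> (length (list_of_tree l) + 1) * (K + 15).
      eval P [x, l, acc] fold_body (foldl G acc (list_of_tree l)) t"
proof (induction l arbitrary: acc)
  case Leaf
  have "eval P [x, Leaf, acc] fold_body acc (1 + 1 + 1)"
    unfolding fold_body_def by (intro eval_IfNode_False eval_Param1 eval_Param2)
  then show ?case by (intro exI conjI) auto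
next
  case (Node h l)
  have acc: "size acc \<le> M"
    using Node.prems(1)[of "[]"] by simp
  obtain t1 where t1: "t1 \<le> K" "eval P [Node x (Node acc h)] (P ! 1) (G acc h) t1"
    using G[OF acc, of h] Node.prems(2) by auto
  have "size (foldl G (G acc h) ys) \<le> M" if "prefix ys (list_of_tree l)" for ys
    using Node.prems(1)[of "h # ys"] that by simp
  then obtain t2 where t2: "t2 \<le> (length (list_of_tree l) + 1) * (K + 15)"
      "eval P [x, l, G acc h] fold_body (foldl G (G acc h) (list_of_tree l)) t2"
    using Node.IH(2)[of "G acc h"] Node.prems(2) by auto
  let ?vs = "[x, Node h l, acc]"
  let ?g = "MkNode (Param 0) (MkNode (Param 2) (Left (Param 1)))"
  have "eval P ?vs ?g (Node x (Node acc (left (Node h l)))) (1 + (1 + (1 + 1) + 1) + 1)"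
    by (intro eval_MkNode eval_Left eval_Param0 eval_Param1 eval_Param2)
  then have "evals P ?vs [?g] [Node x (Node acc h)] (6 + 0)"
    by (intro evals_Cons evals_Nil) (simp add: eval_nat_numeral)
  then have g: "eval P ?vs (Call 1 [?g]) (G acc h) (6 + 0 + t1 + 1)"
    using t1 P by (intro eval_Call) auto
  have "evals P ?vs [Param 0, Right (Param 1), Call 1 [?g]] [x, right (Node h l), G acc h]
      (1 + ((1 + 1) + ((6 + 0 + t1 + 1) + 0)))"
    by (intro evals_Cons evals_Nil eval_Right eval_Param0 eval_Param1 g)
  then have c: "eval P ?vs (Call 0 [Param 0, Right (Param 1), Call 1 [?g]])
      (foldl G (G acc h) (list_of_tree l)) (1 + ((1 + 1) + ((6 + 0 + t1 + 1) + 0)) + t2 + 1)"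
    using t2 P by (intro eval_Call) auto
  have "eval P ?vs fold_body (foldl G (G acc h) (list_of_tree l))
      (1 + (1 + ((1 + 1) + ((6 + 0 + t1 + 1) + 0)) + t2 + 1) + 1)"
    unfolding fold_body_def by (rule eval_IfNode_True[OF eval_Param1 c])
  then show ?case
    using t1(1) t2(1)
    by (intro exI[of _ "1 + (1 + ((1 + 1) + ((6 + 0 + t1 + 1) + 0)) + t2 + 1) + 1"]) auto
qed

lemma fpt_foldl_bounded:
  assumes g: "fpt (\<lambda>z. G (left z) (left (right z)) (right (right z)))"
    and l: "fptl l" and a: "fpt a"
    and bound: "\<And>(x :: tree) ys. prefix ys (l x) \<Longrightarrow> size (foldl (G x) (a x) ys) \<le> poly q (size x)"
  shows "fpt (\<lambda>x :: tree. foldl (G x) (a x) (l x))"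
proof -
  obtain P eg pg el pl ea pa
    where *: "realizes P eg pg (\<lambda>z. G (left z) (left (right z)) (right (right z)))"
      "realizes P el pl (\<lambda>x. tree_of_list (l x))" "realizes P ea pa a"
    using fpt_common3[OF g _ a] l[unfolded fptl_def] by metis
  \<comment> \<open>\<open>fold_body\<close> calls functions 0 and 1 by absolute index, so it and
    the step body come first and all other code is moved by 2.\<close>
  define Q where "Q = [fold_body, shift 2 eg]"
  define R where "R = Q @ map (shift 2) P"
  have [simp]: "length Q = 2" by (simp add: Q_def)
  have R: "realizes R (shift 2 eg) pg (\<lambda>z. G (left z) (left (right z)) (right (right z)))"
      "realizes R (shift 2 el) pl (\<lambda>x. tree_of_list (l x))" "realizes R (shift 2 ea) pa a"
    using *[THEN realizes_shift, of Q] by (simp_all add: R_def)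
  have nth: "R ! 0 = fold_body" "R ! 1 = shift 2 eg" "1 < length R"
    by (simp_all add: R_def Q_def)
  \<comment> \<open>The step receives \<open>Node x (Node acc h)\<close>: two nodes, the
    environment, a head bounded by \<open>pl\<close> and an accumulator bounded by
    \<open>q\<close>.\<close>
  define pK where "pK = pcompose pg ([:2, 1:] + pl + q)"
  define p where "p = (pl + 1) * (pK + [:15:]) + pl + pa + q + [:2:]"
  have "realizes R (Call 0 [Param 0, shift 2 el, shift 2 ea]) p (\<lambda>x. foldl (G x) (a x) (l x))"
    unfolding realizes_def
  proof (intro allI conjI)
    fix x :: tree
    let ?n = "size x"
    show "size (foldl (G x) (a x) (l x)) \<le> poly p ?n"
      using bound[of "l x" x] by (simp add: p_def)
    define K where "K = poly pK ?n"
    have sl: "size (tree_of_list (l x)) \<le> poly pl ?n"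
      using realizes_size[OF R(2)] .
    have "\<exists>t \<le> K. eval R [Node x (Node acc h)] (R ! 1) (G x acc h) t"
      if "size acc \<le> poly q ?n" "size h \<le> poly pl ?n" for acc h
    proof -
      obtain t where t: "t \<le> poly pg (size (Node x (Node acc h)))"
          "eval R [Node x (Node acc h)] (shift 2 eg) (G x acc h) t"
        using realizes_eval[OF R(1), of "Node x (Node acc h)"] by auto
      have "poly pg (size (Node x (Node acc h))) \<le> K"
        unfolding K_def pK_def poly_pcompose using that by (intro poly_nat_mono) simp
      then show ?thesis using t nth by (metis order_trans)
    qed
    note F = eval_fold_body[where x = x and G = "G x", OF this nth(1,3), where l = "tree_of_list (l x)" and acc = "a x"]
    obtain t1 where t1: "t1 \<le> (length (l x) + 1) * (K + 15)"
      "eval R [x, tree_of_list (l x), a x] fold_body (foldl (G x) (a x) (l x)) t1"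
      using F[of "poly q ?n" "poly pl ?n"] bound sl by auto
    obtain t2 t3 where t: "t2 \<le> poly pl ?n" "eval R [x] (shift 2 el) (tree_of_list (l x)) t2"
       "t3 \<le> poly pa ?n" "eval R [x] (shift 2 ea) (a x) t3"
      using R realizes_eval by metis
    have "evals R [x] [Param 0, shift 2 el, shift 2 ea] [x, tree_of_list (l x), a x] (1 + (t2 + (t3 + 0)))"
      by (intro evals_Cons evals_Nil eval_Param0 t)
    then have "eval R [x] (Call 0 [Param 0, shift 2 el, shift 2 ea]) (foldl (G x) (a x) (l x))
        (1 + (t2 + (t3 + 0)) + t1 + 1)"
      using t1 nth by (intro eval_Call) auto
    moreover have "(length (l x) + 1) * (K + 15) \<le> (poly pl ?n + 1) * (K + 15)"
      using sl length_le_size[of "l x"] by (intro mult_le_mono) auto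
    then have "t1 \<le> (poly pl ?n + 1) * (K + 15)"
      using t1(1) by (rule order_trans[rotated])
    then have "1 + (t2 + (t3 + 0)) + t1 + 1 \<le> poly p ?n"
      using t unfolding p_def K_def by simp
    ultimately show "\<exists>t\<le>poly p ?n.
        eval R [x] (Call 0 [Param 0, shift 2 el, shift 2 ea]) (foldl (G x) (a x) (l x)) t"
      by blast
  qed
  then show ?thesis by (rule fptI)
qed

text \<open>Each step adds an amount that depends on the environment and the head but not on the
  accumulator, so increments add up instead of compounding; a step that doubles its accumulator is
  excluded.\<close>

lemma fpt_foldl:
  assumes g: "fpt (\<lambda>z. G (left z) (left (right z)) (right (right z)))"
    and l: "fptl l" and a: "fpt a"
    and growth: "\<And>x acc h. size (G x acc h) \<le> size acc + poly q (size x + size h)"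
  shows "fpt (\<lambda>x. foldl (G x) (a x) (l x))"
proof -
  obtain pl where pl: "\<And>x. size (tree_of_list (l x)) \<le> poly pl (size x)"
    using fpt_size l fptl_def by metis
  obtain pa where pa: "\<And>x. size (a x) \<le> poly pa (size x)"
    using fpt_size a by metis
  have fold: "size (foldl (G x) acc ys) \<le> size acc + length ys * poly q (size x + N)"
    if "\<forall>y\<in>set ys. size y \<le> N" for x acc :: tree and ys N
    using that
  proof (induction ys arbitrary: acc)
    case (Cons y ys)
    have "size (foldl (G x) acc (y # ys)) \<le> size (G x acc y) + length ys * poly q (size x + N)"
      using Cons by simp
    also have "size (G x acc y) \<le> size acc + poly q (size x + size y)"
      by (rule growth)
    also have "poly q (size x + size y) \<le> poly q (size x + N)"
      using Cons by (intro poly_nat_mono) simp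
    finally show ?case by simp
  qed simp
  show ?thesis
  proof (rule fpt_foldl_bounded[OF g l a])
    fix x ys
    assume ys: "prefix ys (l x)"
    have mem: "\<forall>y\<in>set ys. size y \<le> poly pl (size x)"
      using ys pl set_mono_prefix size_tree_of_list_member by (meson order_trans subsetD)
    have len: "length ys \<le> poly pl (size x)"
      using ys pl prefix_length_le length_le_size by (meson order_trans)
    have "size (foldl (G x) (a x) ys)
        \<le> size (a x) + length ys * poly q (size x + poly pl (size x))"
      using fold[OF mem] .
    also have "\<dots> \<le> poly pa (size x) + poly pl (size x) * poly q (size x + poly pl (size x))"
      using pa len by (intro add_mono mult_le_mono) auto
    also have "\<dots> = poly (pa + pl * pcompose q ([:0, 1:] + pl)) (size x)"
      by (simp add: poly_pcompose)
    finally show "size (foldl (G x) (a x) ys) \<le> poly (pa + pl * pcompose q ([:0, 1:] + pl)) (size x)" .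
  qed
qed

text \<open>Moves a fold from list accumulators to their tree codes, where closure under folds is
  available.\<close>

lemma tree_of_list_foldl:
  "tree_of_list (foldl f a ys) =
    foldl (\<lambda>acc h. tree_of_list (f (list_of_tree acc) h)) (tree_of_list a) ys"
  by (induction ys arbitrary: a) auto

lemma fptl_foldl:
  assumes g: "fptl (\<lambda>z. G (left z) (list_of_tree (left (right z))) (right (right z)))"
    and l: "fptl l" and a: "fptl a"
    and growth: "\<And>x acc h. size (tree_of_list (G x acc h)) \<le>
      size (tree_of_list acc) + poly q (size x + size h)"
  shows "fptl (\<lambda>x. foldl (G x) (a x) (l x))"
  unfolding fptl_def tree_of_list_foldl
  by (rule fpt_foldl[where q = q])
    (use g l a growth[of _ "list_of_tree _"] in \<open>auto simp: fptl_def\<close>)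

lemma fptl_rev [fpt_intros]:
  assumes "fptl l"
  shows "fptl (\<lambda>x. rev (l x))"
proof -
  have "foldl (\<lambda>acc h. h # acc) ys xs = rev xs @ ys" for xs ys :: "tree list"
    by (induction xs arbitrary: ys) auto
  moreover have "fptl (\<lambda>x. foldl (\<lambda>acc h. h # acc) [] (l x))"
    by (rule fptl_foldl[where q = "[:1, 1:]"]) (auto intro!: fpt_intros assms)
  ultimately show ?thesis by simp
qed

lemma fptl_append [fpt_intros]:
  assumes "fptl l" "fptl m"
  shows "fptl (\<lambda>x. l x @ m x)"
proof -
  have "foldl (\<lambda>acc h. h # acc) ys xs = rev xs @ ys" for xs ys :: "tree list"
    by (induction xs arbitrary: ys) auto
  moreover have "fptl (\<lambda>x. foldl (\<lambda>acc h. h # acc) (m x) (rev (l x)))"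
    by (rule fptl_foldl[where q = "[:1, 1:]"]) (auto intro!: fpt_intros assms)
  ultimately show ?thesis by simp
qed

lemma fptl_concat_map [fpt_intros]:
  assumes f: "fptl (\<lambda>z. f (left z) (right z))" and l: "fptl l"
  shows "fptl (\<lambda>x. concat (map (f x) (l x)))"
proof -
  obtain q where q: "\<And>z. size (tree_of_list (f (left z) (right z))) \<le> poly q (size z)"
    using fpt_size f fptl_def by metis
  have fold: "foldl (\<lambda>acc h. acc @ f x h) ys xs = ys @ concat (map (f x) xs)" for x xs ys
    by (induction xs arbitrary: ys) auto
  have f': "fptl (\<lambda>z. f (left z) (right (right z)))"
    using fptl_comp[OF f, of "\<lambda>z. Node (left z) (right (right z))"] by (simp add: fpt_intros)
  have "fptl (\<lambda>x. foldl (\<lambda>acc h. acc @ f x h) [] (l x))"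
  proof (rule fptl_foldl[where q = "pcompose q [:1, 1:]"])
    show "size (tree_of_list (acc @ f x h)) \<le>
        size (tree_of_list acc) + poly (pcompose q [:1, 1:]) (size x + size h)" for x acc h
      using q[of "Node x h"] by (simp add: poly_pcompose)
  qed (intro fpt_intros f' l)+
  then show ?thesis by (simp add: fold)
qed

lemma fptl_map [fpt_intros]:
  assumes "fpt (\<lambda>z. f (left z) (right z))" "fptl l"
  shows "fptl (\<lambda>x. map (f x) (l x))"
proof -
  have "fptl (\<lambda>x. concat (map (\<lambda>h. [f x h]) (l x)))"
    by (intro fpt_intros assms)
  moreover have "concat (map (\<lambda>h. [f x h]) xs) = map (f x) xs" for x xs
    by (induction xs) auto
  ultimately show ?thesis by simp
qed

lemma fptl_filter [fpt_intros]:
  assumes "fptb (\<lambda>z. c (left z) (right z))" "fptl l"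
  shows "fptl (\<lambda>x. filter (c x) (l x))"
proof -
  have "fptl (\<lambda>x. concat (map (\<lambda>h. if c x h then [h] else []) (l x)))"
    by (intro fpt_intros assms)
  moreover have "concat (map (\<lambda>h. if c x h then [h] else []) xs) = filter (c x) xs" for x xs
    by (induction xs) auto
  ultimately show ?thesis by simp
qed

lemma fptb_Bex [fpt_intros]:
  assumes "fptb (\<lambda>z. c (left z) (right z))" "fptl l"
  shows "fptb (\<lambda>x. \<exists>y\<in>set (l x). c x y)"
proof -
  have "fptb (\<lambda>x. \<not> tree_of_list (filter (c x) (l x)) = Leaf)"
    by (intro fpt_intros assms)
  then show ?thesis by (simp add: filter_empty_conv)
qed

lemma fptb_Ball [fpt_intros]:
  assumes "fptb (\<lambda>z. c (left z) (right z))" "fptl l"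
  shows "fptb (\<lambda>x. \<forall>y\<in>set (l x). c x y)"
proof -
  have "fptb (\<lambda>x. tree_of_list (filter (\<lambda>y. \<not> c x y) (l x)) = Leaf)"
    by (intro fpt_intros assms)
  then show ?thesis by (simp add: filter_empty_conv)
qed

lemma fptb_set_eq [fpt_intros]:
  assumes "fptl l" "fptl m"
  shows "fptb (\<lambda>x. set (l x) = set (m x))"
proof -
  have l: "fptl (\<lambda>z. l (left z))" and m: "fptl (\<lambda>z. m (left z))"
    using fptl_comp[OF _ fpt_left[OF fpt_id]] assms by blast+
  have "fptb (\<lambda>x. (\<forall>a\<in>set (l x). \<exists>b\<in>set (m x). a = b) \<and> (\<forall>a\<in>set (m x). \<exists>b\<in>set (l x). a = b))"
    by (intro fpt_intros l m assms)
  moreover have "(\<lambda>x. (\<forall>a\<in>set (l x). \<exists>b\<in>set (m x). a = b) \<and>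
      (\<forall>a\<in>set (m x). \<exists>b\<in>set (l x). a = b)) = (\<lambda>x. set (l x) = set (m x))"
    by (intro ext) blast
  ultimately show ?thesis by (simp only:)
qed

lemma fptl_map2_Node [fpt_intros]:
  assumes "fptl l" "fptl m"
  shows "fptl (\<lambda>x. map2 Node (l x) (m x))"
proof -
  \<comment> \<open>A fold consumes only one list, so the accumulator pairs what is left of the
    second list with the output so far. Once the second list is exhausted the step idles, just as
    \<open>zip\<close> truncates.\<close>
  define step where "step acc h =
    (if left acc = Leaf then acc
     else Node (right (left acc)) (tree_of_list (list_of_tree (right acc) @ [Node h (left (left acc))])))"
    for acc h
  have fold: "right (foldl step (Node (tree_of_list ys) (tree_of_list zs)) xs) =
      tree_of_list (zs @ map2 Node xs ys)" for xs ys zs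
  proof (induction xs arbitrary: ys zs)
    case (Cons x xs)
    show ?case
    proof (cases ys)
      case Nil
      then show ?thesis using Cons[of "[]" zs] by (simp add: step_def)
    next
      case (Cons y ys')
      then show ?thesis using Cons.IH[of ys' "zs @ [Node x y]"] by (simp add: step_def)
    qed
  qed simp
  have "fpt (\<lambda>x. foldl step (Node (tree_of_list (m x)) Leaf) (l x))"
  proof (rule fpt_foldl[where q = "[:3, 1:]"])
    show "size (step acc h) \<le> size acc + poly [:3, 1:] (size x + size h)" for x acc h :: tree
    proof (cases acc)
      case (Node r out)
      then show ?thesis by (cases r) (auto simp: step_def)
    qed (simp add: step_def)
  qed (auto simp: step_def intro!: fpt_intros assms)
  then have "fpt (\<lambda>x. right (foldl step (Node (tree_of_list (m x)) Leaf) (l x)))"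
    by (intro fpt_intros)
  then show ?thesis
    using fold[where zs = "[]"] by (simp add: fptl_def)
qed

text \<open>The relation is a parameter because tuples are compared by equality, but listings of
  unions by their underlying sets.\<close>

definition dedup :: "('a \<Rightarrow> 'a \<Rightarrow> bool) \<Rightarrow> 'a list \<Rightarrow> 'a list" where
  "dedup E = foldl (\<lambda>acc h. if \<exists>y\<in>set acc. E y h then acc else h # acc) []"

lemma fptl_dedup [fpt_intros]:
  assumes E: "fptb (\<lambda>z. E (left z) (left (right z)) (right (right z)))" and l: "fptl l"
  shows "fptl (\<lambda>x. dedup (E x) (l x))"
proof -
  have E': "fptb (\<lambda>z. E (left (left z)) (right z) (right (right (left z))))"
    using fptb_comp[OF E, of "\<lambda>z. Node (left (left z)) (Node (right z) (right (right (left z))))"]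
    by (simp add: fpt_intros)
  show ?thesis
    unfolding dedup_def
    by (rule fptl_foldl[where q = "[:1, 1:]"]) (auto intro!: fpt_intros E' l)
qed

fun kcat :: "nat \<Rightarrow> 'a list list \<Rightarrow> 'a list list" where
  "kcat 0 xss = [[]]"
| "kcat (Suc k) xss = concat (map (\<lambda>xs. map (\<lambda>ys. xs @ ys) (kcat k xss)) xss)"

text \<open>The recursion on \<open>k\<close> takes place outside the program: each \<open>k\<close>
  has its own program, with \<open>k\<close> nested loops. This is where the exponent of the running
  time comes to depend on \<open>k\<close>.\<close>

lemma fptl_kcat [fpt_intros]:
  assumes "fptl l"
  shows "fptl (\<lambda>x. map tree_of_list (kcat k (map list_of_tree (l x))))"
proof (induction k)
  case 0
  have "fptl (\<lambda>x. [Leaf])"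
    by (intro fpt_intros)
  then show ?case by simp
next
  case (Suc k)
  have IH: "fptl (\<lambda>z. map tree_of_list (kcat k (map list_of_tree (l (left z)))))"
    using fptl_comp[OF Suc, of left] by (simp add: fpt_intros)
  have "fptl (\<lambda>x. concat (map (\<lambda>t. map (\<lambda>u. tree_of_list (list_of_tree t @ list_of_tree u))
      (map tree_of_list (kcat k (map list_of_tree (l x))))) (l x)))"
    by (intro fpt_intros IH assms)
  then show ?case
    by (simp add: map_concat comp_def)
qed

section \<open>The output of the algorithm and the cover game\<close>

lemma successively_invariant:
  assumes step: "\<And>x y. I x \<Longrightarrow> R x y \<Longrightarrow> I y"
  shows "successively R xs \<Longrightarrow> xs \<noteq> [] \<Longrightarrow> I (hd xs) \<Longrightarrow> \<forall>x\<in>set xs. I x"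
proof (induction xs rule: induct_list012)
  case (3 x y zs)
  have "R x y" "successively R (y # zs)" "I x"
    using "3.prems" by simp_all
  then have "\<forall>z\<in>set (y # zs). I z"
    using "3.IH"(2) step by (metis list.sel(1) list.simps(3))
  then show ?case using \<open>I x\<close> by simp
qed simp_all

lemma execution_invariant:
  assumes "execution k ord \<sigma> A B Bs" "I (union_target k ord \<sigma> A B)"
    "\<And>B1 B2. I B1 \<Longrightarrow> removal k ord \<sigma> A B1 B2 \<Longrightarrow> I B2"
  shows "\<forall>B'\<in>set Bs. I B'"
  using successively_invariant[of I "removal k ord \<sigma> A" Bs] assms unfolding execution_def by metis

text \<open>Turns the position-wise agreement in \<open>projective_hom\<close> into agreement of two
  partial maps on a common part of their domains; distinctness lets an element of \<open>xs\<close>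
  determine its position.\<close>

lemma agree_nth_iff:
  assumes "distinct xs" "length ys = length xs"
  shows "(\<forall>i<length xs. xs ! i \<in> dom h \<longrightarrow> h (xs ! i) = Some (ys ! i)) \<longleftrightarrow>
    (\<forall>a\<in>set xs \<inter> dom h. h a = map_of (zip xs ys) a)"
proof -
  have "map_of (zip xs ys) (xs ! i) = Some (ys ! i)" if "i < length xs" for i
    using assms that by (simp add: map_of_zip_nth)
  then show ?thesis
    by (metis IntD1 IntD2 IntI in_set_conv_nth nth_mem)
qed

lemma projective_hom_mono:
  assumes "projective_hom \<sigma> A B h" "g \<subseteq>\<^sub>m h"
  shows "projective_hom \<sigma> A B g"
proof -
  have "dom g \<subseteq> dom h" "ran g \<subseteq> ran h"
    using assms(2) map_le_implies_dom_le by (auto simp: map_le_def ran_def dom_def) (metis domI assms(2) map_le_def)+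
  moreover have "g a = h a" if "a \<in> dom g" for a
    using assms(2) that by (simp add: map_le_def)
  ultimately show ?thesis
    using assms(1) unfolding projective_hom_def by (smt (verit, best) subsetD subset_trans)
qed

lemma winning_strategyD:
  assumes "winning_strategy k \<sigma> A B H"
  shows "H \<noteq> {}" "\<And>h. h \<in> H \<Longrightarrow> projective_hom \<sigma> A B h"
    "\<And>h g. h \<in> H \<Longrightarrow> g \<subseteq>\<^sub>m h \<Longrightarrow> g \<in> H"
    "\<And>h a. h \<in> H \<Longrightarrow> a \<in> universe A \<Longrightarrow> a \<notin> dom h \<Longrightarrow> weight \<sigma> A (insert a (dom h)) \<le> k \<Longrightarrow>
      \<exists>h'\<in>H. h \<subseteq>\<^sub>m h' \<and> dom h' = insert a (dom h)"
proof -
  note * = assms[unfolded winning_strategy_def]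
  show "H \<noteq> {}"
    using * by (rule conjunct1)
  show "projective_hom \<sigma> A B h" if "h \<in> H" for h
    using *[THEN conjunct2, THEN conjunct1] that by (rule bspec)
  show "g \<in> H" if "h \<in> H" "g \<subseteq>\<^sub>m h" for h g
    by (rule *[THEN conjunct2, THEN conjunct2, THEN conjunct1, rule_format, OF that])
  show "\<exists>h'\<in>H. h \<subseteq>\<^sub>m h' \<and> dom h' = insert a (dom h)"
    if "h \<in> H" "a \<in> universe A" "a \<notin> dom h" "weight \<sigma> A (insert a (dom h)) \<le> k" for h a
    by (rule *[THEN conjunct2, THEN conjunct2, THEN conjunct2, rule_format, OF that])
qed

section \<open>Unions of hyperedges and weight\<close>

locale csp =
  fixes \<sigma> :: "'s rel_signature" and A :: "('s, 'a) rel_struct" and B :: "('s, 'b) rel_struct"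
  assumes csp: "csp_instance \<sigma> A B"
begin

lemma rel_source: "R \<in> symbols \<sigma> \<Longrightarrow> as \<in> rel A R \<Longrightarrow> length as = arity \<sigma> R \<and> set as \<subseteq> universe A"
  using csp by (auto simp: csp_instance_def finite_structure_def)

lemma rel_target: "R \<in> symbols \<sigma> \<Longrightarrow> bs \<in> rel B R \<Longrightarrow> length bs = arity \<sigma> R \<and> set bs \<subseteq> universe B"
  using csp by (auto simp: csp_instance_def finite_structure_def)

lemma hyperedge_subset: "e \<in> hyperedges \<sigma> A \<Longrightarrow> e \<subseteq> universe A"
  using rel_source by (auto simp: hyperedges_def)

lemma k_union_universe: "k_union j \<sigma> A U \<Longrightarrow> U \<subseteq> universe A"
  using hyperedge_subset by (auto simp: k_union_def)

end

text \<open>The listing is arbitrary here; the one used by the program is substituted for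
  \<open>ord\<close> only later.\<close>

locale algorithm = csp \<sigma> A B
  for \<sigma> :: "'s rel_signature" and A :: "('s, 'a) rel_struct" and B :: "('s, 'b) rel_struct" +
  fixes k :: nat and ord :: "'a set \<Rightarrow> 'a list"
  assumes listing: "listing k \<sigma> A ord"
begin

abbreviation "\<sigma>' \<equiv> union_signature k \<sigma> A"
abbreviation "A' \<equiv> union_source k ord \<sigma> A"
abbreviation "B\<^sub>0 \<equiv> union_target k ord \<sigma> A B"

definition tup :: "'a set \<Rightarrow> 'b list \<Rightarrow> 'a \<rightharpoonup> 'b" where
  "tup U bs = map_of (zip (ord U) bs)"

lemma ord: "k_union k \<sigma> A U \<Longrightarrow> distinct (ord U)" "k_union k \<sigma> A U \<Longrightarrow> set (ord U) = U"
  "k_union k \<sigma> A U \<Longrightarrow> length (ord U) = card U"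
  using listing distinct_card unfolding listing_def by metis+

lemma finite_universe: "finite (universe A)" "finite (universe B)"
  using csp by (auto simp: csp_instance_def finite_structure_def)

lemma finite_hyperedges: "finite (hyperedges \<sigma> A)"
  using hyperedge_subset finite_universe(1) by (meson finite_Pow_iff finite_subset PowI subsetI)

lemma finite_k_union: "finite {U. k_union k \<sigma> A U}"
proof -
  have "{U. k_union k \<sigma> A U} \<subseteq> Pow (universe A)"
    using k_union_universe by auto
  then show ?thesis
    using finite_universe(1) finite_subset by auto
qed

text \<open>A \<open>k\<close>-union takes exactly \<open>k\<close> hyperedges, repetitions allowed,
  so a shorter list is padded with copies of any hyperedge. This is where some hyperedge has to
  exist.\<close>

lemma k_union_mono:
  assumes "k_union j \<sigma> A U" "j \<le> k" "hyperedges \<sigma> A \<noteq> {}"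
  shows "\<exists>V. k_union k \<sigma> A V \<and> U \<subseteq> V"
proof -
  obtain es where es: "length es = j" "set es \<subseteq> hyperedges \<sigma> A" "U = \<Union>(set es)"
    using assms(1) by (auto simp: k_union_def)
  obtain e where "e \<in> hyperedges \<sigma> A"
    using assms(3) by blast
  then have "k_union k \<sigma> A (\<Union>(set (es @ replicate (k - j) e)))"
    using es assms(2) unfolding k_union_def by (intro exI[of _ "es @ replicate (k - j) e"]) auto
  then show ?thesis using es by auto
qed

lemma k_union_of_hyperedge:
  assumes "e \<in> hyperedges \<sigma> A" "k \<ge> 1"
  shows "k_union k \<sigma> A e"
  unfolding k_union_def using assms by (intro exI[of _ "replicate k e"]) auto

text \<open>All hyperedges together form a union, so the least number in the definition of weight is
  attained; padding then leads from this number to exactly \<open>k\<close>.\<close>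

lemma weight_le_iff:
  assumes "hyperedges \<sigma> A \<noteq> {}"
  shows "weight \<sigma> A X \<le> k \<longleftrightarrow> (\<exists>U. k_union k \<sigma> A U \<and> X \<inter> \<Union>(hyperedges \<sigma> A) \<subseteq> U)"
proof
  let ?P = "\<lambda>j. \<exists>U. k_union j \<sigma> A U \<and> X \<inter> \<Union>(hyperedges \<sigma> A) \<subseteq> U"
  obtain es where "set es = hyperedges \<sigma> A"
    using finite_hyperedges finite_list by blast
  then have "?P (length es)"
    by (intro exI[of _ "\<Union>(hyperedges \<sigma> A)"]) (auto simp: k_union_def)
  then have "?P (weight \<sigma> A X)"
    unfolding weight_def by (rule LeastI)
  then show "?P k" if "weight \<sigma> A X \<le> k"
    using k_union_mono[OF _ that assms] by blast
  show "weight \<sigma> A X \<le> k" if "?P k"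
    unfolding weight_def using that by (rule Least_le)
qed

section \<open>Tuples of the target structures as partial maps\<close>

lemma mem_target_iff: "bs \<in> rel B\<^sub>0 U \<longleftrightarrow>
    k_union k \<sigma> A U \<and> length bs = length (ord U) \<and> projective_hom \<sigma> A B (tup U bs)"
  by (auto simp: union_target_def tup_def)

lemma dom_tup: "k_union k \<sigma> A U \<Longrightarrow> length bs = length (ord U) \<Longrightarrow> dom (tup U bs) = U"
  using ord by (simp add: tup_def)

lemma ran_tup: "k_union k \<sigma> A U \<Longrightarrow> length bs = length (ord U) \<Longrightarrow> ran (tup U bs) = set bs"
  using ord by (simp add: tup_def ran_map_of_zip)

lemma universe_target [simp]: "universe B\<^sub>0 = universe B"
  by (simp add: union_target_def)

text \<open>The basic invariant of executions: it hands down to every later structure what the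
  initial tuples satisfy by construction, namely their length and the test against \<open>A\<close>
  and \<open>B\<close>.\<close>

definition subtarget :: "('a set, 'b) rel_struct \<Rightarrow> bool" where
  "subtarget B1 \<longleftrightarrow> universe B1 = universe B \<and> (\<forall>U. rel B1 U \<subseteq> rel B\<^sub>0 U)"

lemma subtarget_removal:
  assumes "subtarget B1" "removal k ord \<sigma> A B1 B2"
  shows "subtarget B2"
proof -
  have "rel B2 U \<subseteq> rel B1 U" for U
    using assms(2) by (auto simp: removal_def split: if_splits)
  moreover have "universe B2 = universe B1"
    using assms(2) by (auto simp: removal_def)
  ultimately show ?thesis
    using assms(1) unfolding subtarget_def by (metis order_trans)
qed

lemma subtarget_execution:
  assumes "execution k ord \<sigma> A B Bs" "B1 \<in> set Bs"
  shows "subtarget B1"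
proof -
  have "\<forall>B'\<in>set Bs. subtarget B'"
  proof (rule execution_invariant[OF assms(1)])
    show "subtarget B\<^sub>0" by (simp add: subtarget_def)
  qed (rule subtarget_removal)
  then show ?thesis using assms(2) by blast
qed

lemma subtarget_mem:
  assumes "subtarget B1" "bs \<in> rel B1 U"
  shows "k_union k \<sigma> A U" "length bs = length (ord U)" "projective_hom \<sigma> A B (tup U bs)"
  using assms mem_target_iff unfolding subtarget_def by blast+

lemma subtarget_set:
  assumes "subtarget B1" "bs \<in> rel B1 U"
  shows "set bs \<subseteq> universe B"
  using subtarget_mem[OF assms] ran_tup projective_hom_def by metis

lemma csp_instance_subtarget:
  assumes "subtarget B1"
  shows "csp_instance \<sigma>' A' B1"
  unfolding csp_instance_def finite_structure_def
proof (intro conjI ballI)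
  show "finite (symbols \<sigma>')" using finite_k_union by (simp add: union_signature_def)
  show "finite (universe A')" "finite (universe B1)"
    using finite_universe assms by (auto simp: union_source_def subtarget_def)
next
  fix U as
  assume "U \<in> symbols \<sigma>'" "as \<in> rel A' U"
  then show "length as = arity \<sigma>' U" "set as \<subseteq> universe A'"
    using ord k_union_universe by (auto simp: union_signature_def union_source_def)
next
  fix U bs
  assume "U \<in> symbols \<sigma>'" "bs \<in> rel B1 U"
  then show "length bs = arity \<sigma>' U" "set bs \<subseteq> universe B1"
    using subtarget_mem[OF assms] subtarget_set[OF assms] assms ord
    by (auto simp: union_signature_def subtarget_def)
qed

text \<open>Exhibits the removal test as consistency between overlapping unions: taken for
  \<open>h = tup U bs\<close>, it asks every union for a remaining tuple that agrees with
  \<open>bs\<close> on the overlap with \<open>U\<close>.\<close>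

lemma projective_hom_union_iff:
  assumes "subtarget B1"
  shows "projective_hom \<sigma>' A' B1 h \<longleftrightarrow> dom h \<subseteq> universe A \<and> ran h \<subseteq> universe B \<and>
    (\<forall>U. k_union k \<sigma> A U \<longrightarrow> (\<exists>bs\<in>rel B1 U. \<forall>a\<in>U \<inter> dom h. h a = tup U bs a))"
proof -
  have "(\<forall>i<card U. ord U ! i \<in> dom h \<longrightarrow> h (ord U ! i) = Some (bs ! i)) \<longleftrightarrow>
      (\<forall>a\<in>U \<inter> dom h. h a = tup U bs a)" if "bs \<in> rel B1 U" for U bs
    using agree_nth_iff[of "ord U" bs h] subtarget_mem[OF assms that] ord[of U] by (simp add: tup_def)
  then have "(\<exists>bs\<in>rel B1 U. \<forall>i<card U. ord U ! i \<in> dom h \<longrightarrow> h (ord U ! i) = Some (bs ! i)) \<longleftrightarrow>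
      (\<exists>bs\<in>rel B1 U. \<forall>a\<in>U \<inter> dom h. h a = tup U bs a)" for U
    by blast
  then show ?thesis
    using assms
    by (simp add: projective_hom_def union_signature_def union_source_def subtarget_def)
qed

lemma removal_cases:
  assumes "removal k ord \<sigma> A B1 B2"
  obtains U bs where "k_union k \<sigma> A U" "bs \<in> rel B1 U" "\<not> projective_hom \<sigma>' A' B1 (tup U bs)"
    "B2 = B1\<lparr>rel := (rel B1)(U := rel B1 U - {bs})\<rparr>"
  using assms unfolding removal_def tup_def by blast

lemma complete_projective_hom:
  assumes "complete_execution k ord \<sigma> A B Bs" "k_union k \<sigma> A U" "bs \<in> rel (last Bs) U"
  shows "projective_hom \<sigma>' A' (last Bs) (tup U bs)"
  using assms unfolding complete_execution_def removal_def tup_def by blast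

lemma last_subtarget:
  assumes "complete_execution k ord \<sigma> A B Bs"
  shows "subtarget (last Bs)"
  using assms subtarget_execution unfolding complete_execution_def execution_def
  by (metis last_in_set execution_def)

subsection \<open>Satisfying assignments\<close>

lemma satisfying_iff_subtarget:
  assumes "subtarget B1"
  shows "h \<in> satisfying_assignments \<sigma>' A' B1 \<longleftrightarrow>
    h \<in> universe A \<rightarrow>\<^sub>E universe B \<and> (\<forall>U. k_union k \<sigma> A U \<longrightarrow> map h (ord U) \<in> rel B1 U)"
  using assms
  by (auto simp: satisfying_assignments_def union_signature_def union_source_def subtarget_def)

lemma tup_map:
  "k_union k \<sigma> A U \<Longrightarrow> tup U (map h (ord U)) = (\<lambda>a. if a \<in> U then Some (h a) else None)"
  using ord by (simp add: tup_def map_of_zip_map)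

text \<open>The tuples read off from one assignment \<open>h\<close> support one another: for every
  \<open>V\<close> the tuple \<open>map h (ord V)\<close> agrees with all of them on overlaps. Hence
  none of them can be the first to be removed.\<close>

lemma satisfying_assignments_subset:
  assumes "execution k ord \<sigma> A B Bs" "B1 \<in> set Bs" "h \<in> satisfying_assignments \<sigma> A B"
  shows "h \<in> satisfying_assignments \<sigma>' A' B1"
proof -
  have h: "h \<in> universe A \<rightarrow>\<^sub>E universe B"
    "\<And>R as. R \<in> symbols \<sigma> \<Longrightarrow> as \<in> rel A R \<Longrightarrow> map h as \<in> rel B R"
    using assms(3) by (auto simp: satisfying_assignments_def)
  define I where "I B1 \<longleftrightarrow> subtarget B1 \<and> (\<forall>U. k_union k \<sigma> A U \<longrightarrow> map h (ord U) \<in> rel B1 U)" for B1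
  have range: "dom (tup U (map h (ord U))) \<subseteq> universe A" "ran (tup U (map h (ord U))) \<subseteq> universe B"
    if "k_union k \<sigma> A U" for U
    using k_union_universe[OF that] h(1) that
    by (auto simp: tup_map ran_def split: if_splits)
  have "\<forall>B'\<in>set Bs. I B'"
  proof (rule execution_invariant[OF assms(1)])
    have "projective_hom \<sigma> A B (tup U (map h (ord U)))" if U: "k_union k \<sigma> A U" for U
      unfolding projective_hom_def
    proof (intro conjI range[OF U] ballI)
      fix R as
      assume R: "R \<in> symbols \<sigma>" "as \<in> rel A R"
      show "\<exists>bs\<in>rel B R. \<forall>i<arity \<sigma> R. as ! i \<in> dom (tup U (map h (ord U))) \<longrightarrow>
          tup U (map h (ord U)) (as ! i) = Some (bs ! i)"
        using h(2)[OF R] rel_source[OF R] U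
        by (intro bexI[of _ "map h as"]) (auto simp: tup_map split: if_splits)
    qed
    then show "I B\<^sub>0"
      by (auto simp: I_def subtarget_def mem_target_iff)
  next
    fix B1 B2
    assume I: "I B1" and rem: "removal k ord \<sigma> A B1 B2"
    have sub: "subtarget B1" using I I_def by blast
    obtain U bs where U: "k_union k \<sigma> A U" "\<not> projective_hom \<sigma>' A' B1 (tup U bs)"
      "B2 = B1\<lparr>rel := (rel B1)(U := rel B1 U - {bs})\<rparr>"
      using removal_cases[OF rem] by metis
    have "projective_hom \<sigma>' A' B1 (tup U (map h (ord U)))"
      unfolding projective_hom_union_iff[OF sub]
    proof (intro conjI range[OF U(1)] allI impI)
      fix V
      assume "k_union k \<sigma> A V"
      then show "\<exists>bs\<in>rel B1 V. \<forall>a\<in>V \<inter> dom (tup U (map h (ord U))).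
          tup U (map h (ord U)) a = tup V bs a"
        using I U(1) by (intro bexI[of _ "map h (ord V)"]) (auto simp: tup_map I_def split: if_splits)
    qed
    then have "bs \<noteq> map h (ord U)" using U(2) by blast
    then show "I B2"
      using I subtarget_removal[OF sub rem] U(3) by (auto simp: I_def)
  qed
  then have "I B1" using assms(2) by blast
  then show ?thesis
    using h(1) satisfying_iff_subtarget unfolding I_def by blast
qed

text \<open>For \<open>k \<ge> 1\<close> each hyperedge is itself a \<open>k\<close>-union, so the
  scope of every constraint is the whole domain of some tuple; a projective homomorphism defined on
  an entire scope satisfies the constraint.\<close>

lemma satisfying_assignments_subtarget:
  assumes "subtarget B1" "k \<ge> 1" "h \<in> satisfying_assignments \<sigma>' A' B1"
  shows "h \<in> satisfying_assignments \<sigma> A B"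
proof -
  have h: "h \<in> universe A \<rightarrow>\<^sub>E universe B"
    "\<And>U. k_union k \<sigma> A U \<Longrightarrow> map h (ord U) \<in> rel B1 U"
    using assms(3) satisfying_iff_subtarget[OF assms(1)] by auto
  have "map h as \<in> rel B R" if R: "R \<in> symbols \<sigma>" "as \<in> rel A R" for R as
  proof -
    have U: "k_union k \<sigma> A (set as)"
      using R assms(2) by (intro k_union_of_hyperedge) (auto simp: hyperedges_def)
    then have "projective_hom \<sigma> A B (tup (set as) (map h (ord (set as))))"
      using subtarget_mem(3)[OF assms(1)] h(2) by blast
    then obtain bs where bs: "bs \<in> rel B R"
        "\<forall>i<arity \<sigma> R. as ! i \<in> dom (tup (set as) (map h (ord (set as)))) \<longrightarrow>
          tup (set as) (map h (ord (set as))) (as ! i) = Some (bs ! i)"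
      using R unfolding projective_hom_def by blast
    have "bs ! i = h (as ! i)" if "i < length as" for i
      using bs(2) rel_source[OF R] that U by (auto simp: tup_map split: if_splits)
    then have "map h as = bs"
      using rel_source[OF R] rel_target[OF R(1) bs(1)] by (intro nth_equalityI) auto
    then show ?thesis using bs by simp
  qed
  then show ?thesis using h(1) by (auto simp: satisfying_assignments_def)
qed

subsection \<open>Winning strategies\<close>

text \<open>The game adds one element at a time. While all domains stay inside one
  \<open>k\<close>-union \<open>U\<close> their weight is at most \<open>k\<close>, so moves can be
  iterated until \<open>X\<close> is exhausted.\<close>

lemma strategy_extend:
  assumes H: "winning_strategy k \<sigma> A B H" and h: "h \<in> H" and X: "X \<subseteq> U" "k_union k \<sigma> A U"
    and ne: "hyperedges \<sigma> A \<noteq> {}" and dom: "dom h \<subseteq> U"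
  shows "\<exists>h'\<in>H. h \<subseteq>\<^sub>m h' \<and> dom h' = dom h \<union> X"
proof -
  have "finite X"
    using X k_union_universe finite_universe by (meson finite_subset)
  then show ?thesis using X(1)
  proof (induction X rule: finite_induct)
    case empty
    then show ?case using h by (intro bexI[of _ h]) auto
  next
    case (insert a X)
    then obtain h' where h': "h' \<in> H" "h \<subseteq>\<^sub>m h'" "dom h' = dom h \<union> X"
      by auto
    show ?case
    proof (cases "a \<in> dom h'")
      case True
      then show ?thesis using h' by (intro bexI[of _ h']) auto
    next
      case False
      have "a \<in> universe A" using insert.prems k_union_universe[OF X(2)] by auto
      moreover have "weight \<sigma> A (insert a (dom h')) \<le> k"
        unfolding weight_le_iff[OF ne] using X(2) insert.prems dom h'(3)
        by (intro exI[of _ U]) auto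
      ultimately obtain h'' where "h'' \<in> H" "h' \<subseteq>\<^sub>m h''" "dom h'' = insert a (dom h')"
        using winning_strategyD(4)[OF H h'(1) _ False] by blast
      then show ?thesis
        using h' map_le_trans by (intro bexI[of _ h'']) auto
    qed
  qed
qed

lemma tup_the:
  assumes "k_union k \<sigma> A U" "dom h = U"
  shows "tup U (map (the \<circ> h) (ord U)) = h"
proof -
  have "h a = Some (the (h a))" if "a \<in> U" for a
    using that assms(2) by auto
  moreover have "h a = None" if "a \<notin> U" for a
    using that assms(2) by auto
  ultimately show ?thesis using assms(1) by (auto simp: tup_map)
qed

lemma strategy_imp_consistent:
  assumes H: "winning_strategy k \<sigma> A B H" and ne: "hyperedges \<sigma> A \<noteq> {}"
    and ex: "execution k ord \<sigma> A B Bs" "B1 \<in> set Bs"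
    and U: "k_union k \<sigma> A U" and h: "h \<in> H" "dom h = U"
  shows "map (the \<circ> h) (ord U) \<in> rel B1 U"
proof -
  define I where "I B1 \<longleftrightarrow> subtarget B1 \<and>
    (\<forall>U h. k_union k \<sigma> A U \<longrightarrow> h \<in> H \<longrightarrow> dom h = U \<longrightarrow> map (the \<circ> h) (ord U) \<in> rel B1 U)" for B1
  have hom: "projective_hom \<sigma> A B h" if "h \<in> H" for h
    using winning_strategyD(2)[OF H that] .
  have "\<forall>B'\<in>set Bs. I B'"
  proof (rule execution_invariant[OF ex(1)])
    show "I B\<^sub>0"
      using hom by (auto simp: I_def subtarget_def mem_target_iff tup_the)
  next
    fix B1 B2
    assume I: "I B1" and rem: "removal k ord \<sigma> A B1 B2"
    have sub: "subtarget B1" using I I_def by blast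
    obtain U bs where U: "k_union k \<sigma> A U" "\<not> projective_hom \<sigma>' A' B1 (tup U bs)"
      "B2 = B1\<lparr>rel := (rel B1)(U := rel B1 U - {bs})\<rparr>"
      using removal_cases[OF rem] by metis
    have "projective_hom \<sigma>' A' B1 h" if h: "h \<in> H" "dom h = U" for h
      unfolding projective_hom_union_iff[OF sub]
    proof (intro conjI allI impI)
      show "dom h \<subseteq> universe A" "ran h \<subseteq> universe B"
        using hom[OF h(1)] unfolding projective_hom_def by auto
      fix V
      assume V: "k_union k \<sigma> A V"
      \<comment> \<open>The map \<open>h\<close> itself need not extend to \<open>V\<close>, since
        \<open>U \<union> V\<close> may have weight above \<open>k\<close>. Restricting it to
        \<open>V\<close> first keeps all domains inside one union, and the overlap is all that the
        test looks at.\<close>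
      have "h |` V \<subseteq>\<^sub>m h" by (auto simp: map_le_def)
      then have "h |` V \<in> H"
        using winning_strategyD(3)[OF H h(1)] by blast
      moreover have "dom (h |` V) \<subseteq> V" by auto
      ultimately obtain g where g: "g \<in> H" "h |` V \<subseteq>\<^sub>m g" "dom g = dom (h |` V) \<union> V"
        using strategy_extend[OF H _ subset_refl V ne] by blast
      have dg: "dom g = V" using g(3) by auto
      have "h a = g a" if "a \<in> V" "a \<in> dom h" for a
        using g(2) that unfolding map_le_def by (force simp: restrict_map_def)
      then show "\<exists>bs\<in>rel B1 V. \<forall>a\<in>V \<inter> dom h. h a = tup V bs a"
        using I V g(1) dg tup_the[OF V dg] unfolding I_def
        by (intro bexI[of _ "map (the \<circ> g) (ord V)"]) auto
    qed
    then have "bs \<noteq> map (the \<circ> h) (ord U)" if "h \<in> H" "dom h = U" for h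
      using that U(1,2) tup_the by metis
    then show "I B2"
      using I subtarget_removal[OF sub rem] U(3) by (auto simp: I_def)
  qed
  then show ?thesis using ex(2) U h unfolding I_def by blast
qed

text \<open>Elements outside all hyperedges are unconstrained, so the strategy only asks for the
  restriction to the hyperedges to be covered by a surviving tuple.\<close>

lemma consistent_imp_strategy:
  assumes ex: "complete_execution k ord \<sigma> A B Bs"
    and U: "k_union k \<sigma> A U" "bs \<in> rel (last Bs) U" and ne: "\<Union>(hyperedges \<sigma> A) \<noteq> {}"
    and k: "k \<ge> 1"
  shows "\<exists>H. winning_strategy k \<sigma> A B H"
proof -
  let ?E = "\<Union>(hyperedges \<sigma> A)"
  let ?L = "last Bs"
  note sub = last_subtarget[OF ex]
  have step: "\<exists>bs'\<in>rel ?L V. \<forall>a\<in>V \<inter> U. tup U bs a = tup V bs' a"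
    if "k_union k \<sigma> A U" "bs \<in> rel ?L U" "k_union k \<sigma> A V" for U bs V
    using complete_projective_hom[OF ex that(1,2)] that dom_tup subtarget_mem[OF sub that(2)]
    unfolding projective_hom_union_iff[OF sub] by metis
  define H where "H = {h. dom h \<subseteq> universe A \<and> ran h \<subseteq> universe B \<and>
    (\<exists>U bs. k_union k \<sigma> A U \<and> bs \<in> rel ?L U \<and> h |` ?E \<subseteq>\<^sub>m tup U bs)}"
  \<comment> \<open>A default value for elements outside all hyperedges, which the Spoiler may also
    choose. It comes from a surviving tuple on a nonempty hyperedge.\<close>
  obtain b where b: "b \<in> universe B"
  proof -
    obtain e where e: "e \<in> hyperedges \<sigma> A" "e \<noteq> {}" using ne by auto
    then have V: "k_union k \<sigma> A e" using k k_union_of_hyperedge by blast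
    obtain bs' where "bs' \<in> rel ?L e" using step[OF U V] by blast
    then have "length bs' = length (ord e)" "set bs' \<subseteq> universe B"
      using subtarget_mem[OF sub] subtarget_set[OF sub] by blast+
    moreover have "ord e \<noteq> []" using ord(2)[OF V] e(2) by auto
    ultimately show thesis using that by (cases bs') auto
  qed
  have ne': "hyperedges \<sigma> A \<noteq> {}" using ne by auto
  have "winning_strategy k \<sigma> A B H"
    unfolding winning_strategy_def
  proof (intro conjI ballI allI impI)
    have "Map.empty \<in> H" using U by (auto simp: H_def)
    then show "H \<noteq> {}" by blast
  next
    fix h
    assume "h \<in> H"
    then obtain U bs where h: "dom h \<subseteq> universe A" "ran h \<subseteq> universe B" "k_union k \<sigma> A U"
        "bs \<in> rel ?L U" "h |` ?E \<subseteq>\<^sub>m tup U bs"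
      by (auto simp: H_def)
    have "projective_hom \<sigma> A B (h |` ?E)"
      using subtarget_mem(3)[OF sub h(4)] h(5) by (rule projective_hom_mono)
    moreover have "as ! i \<in> ?E" if "R \<in> symbols \<sigma>" "as \<in> rel A R" "i < arity \<sigma> R" for R as i
    proof -
      have "set as \<in> hyperedges \<sigma> A" using that by (auto simp: hyperedges_def)
      moreover have "as ! i \<in> set as" using rel_source[OF that(1,2)] that by auto
      ultimately show ?thesis by blast
    qed
    ultimately show "projective_hom \<sigma> A B h"
      using h(1,2) unfolding projective_hom_def by (simp add: restrict_in)
  next
    fix h g
    assume h: "h \<in> H" and g: "g \<subseteq>\<^sub>m h"
    have "dom g \<subseteq> dom h" "ran g \<subseteq> ran h" "g |` ?E \<subseteq>\<^sub>m h |` ?E"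
      using g by (auto simp: map_le_def ran_def restrict_map_def dom_def) (metis option.distinct(1))
    then show "g \<in> H"
      using h map_le_trans unfolding H_def by (auto; blast)
  next
    fix h a
    assume "h \<in> H" and a: "a \<in> universe A" "a \<notin> dom h" "weight \<sigma> A (insert a (dom h)) \<le> k"
    then obtain U bs where h: "dom h \<subseteq> universe A" "ran h \<subseteq> universe B" "k_union k \<sigma> A U"
        "bs \<in> rel ?L U" "h |` ?E \<subseteq>\<^sub>m tup U bs"
      by (auto simp: H_def)
    \<comment> \<open>\<open>V\<close> covers the constrained part of the new domain, and the
      companion of \<open>bs\<close> at \<open>V\<close> agrees with it on
      \<open>U \<inter> V\<close>. So the companion covers \<open>h\<close> again and supplies the
      value at a constrained \<open>a\<close>.\<close>
    obtain V where V: "k_union k \<sigma> A V" "insert a (dom h) \<inter> ?E \<subseteq> V"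
      using a(3) unfolding weight_le_iff[OF ne'] by blast
    obtain bs' where bs': "bs' \<in> rel ?L V" "\<forall>a\<in>V \<inter> U. tup U bs a = tup V bs' a"
      using step[OF h(3,4) V(1)] by blast
    have len: "length bs' = length (ord V)" "length bs = length (ord U)"
      using subtarget_mem[OF sub] bs'(1) h(4) by blast+
    define c where "c = (if a \<in> ?E then the (tup V bs' a) else b)"
    have aV: "tup V bs' a = Some c" if "a \<in> ?E"
    proof -
      have "a \<in> dom (tup V bs')"
        using V dom_tup[OF V(1) len(1)] that by blast
      then show ?thesis using that by (auto simp: c_def)
    qed
    have "c \<in> universe B"
    proof (cases "a \<in> ?E")
      case True
      then have "c \<in> ran (tup V bs')" using aV by (auto simp: ran_def)
      then show ?thesis
        using ran_tup[OF V(1) len(1)] subtarget_set[OF sub bs'(1)] by auto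
    qed (simp add: b c_def)
    moreover have "h(a \<mapsto> c) |` ?E \<subseteq>\<^sub>m tup V bs'"
      unfolding map_le_def
    proof
      fix x
      assume x: "x \<in> dom (h(a \<mapsto> c) |` ?E)"
      then have xE: "x \<in> ?E" "x = a \<or> x \<in> dom h"
        by (auto simp: restrict_map_def split: if_splits)
      show "(h(a \<mapsto> c) |` ?E) x = tup V bs' x"
      proof (cases "x = a")
        case True
        then show ?thesis using aV xE by (simp add: restrict_map_def)
      next
        case False
        then have x': "x \<in> dom h" "x \<in> V" "x \<in> dom (h |` ?E)" using xE V by auto
        then have "h x = tup U bs x"
          using h(5) unfolding map_le_def restrict_in[OF xE(1), of h, symmetric] by blast
        moreover have "x \<in> U"
          using h(5) x'(3) dom_tup[OF h(3) len(2)] map_le_implies_dom_le by blast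
        ultimately show ?thesis using bs'(2) x' xE False by (simp add: restrict_map_def)
      qed
    qed
    moreover have "dom (h(a \<mapsto> c)) \<subseteq> universe A"
      using h(1) a(1) by simp
    moreover have "ran (h(a \<mapsto> c)) \<subseteq> insert c (ran h)"
      by (auto simp: ran_def)
    ultimately have "h(a \<mapsto> c) \<in> H"
      using h(2) V(1) bs'(1) unfolding H_def by blast
    moreover have "h \<subseteq>\<^sub>m h(a \<mapsto> c)" "dom (h(a \<mapsto> c)) = insert a (dom h)"
      using a(2) by (auto simp: map_le_def)
    ultimately show "\<exists>h'\<in>H. h \<subseteq>\<^sub>m h' \<and> dom h' = insert a (dom h)"
      by blast
  qed
  then show ?thesis by blast
qed

text \<open>The third claim depends on a nonempty hyperedge. If there is no hyperedge, inconsistency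
  is reported vacuously although the Duplicator wins whenever \<open>universe B\<close> is nonempty.
  If all hyperedges are empty, the algorithm may overlook that \<open>universe B\<close> is empty,
  while the Duplicator has no answer to an element of \<open>A\<close>.\<close>

lemma output_correct:
  assumes ex: "complete_execution k ord \<sigma> A B Bs" and k: "k \<ge> 1"
  shows "csp_instance \<sigma>' A' (last Bs)"
    and "satisfying_assignments \<sigma>' A' (last Bs) = satisfying_assignments \<sigma> A B"
    and "\<Union>(hyperedges \<sigma> A) \<noteq> {} \<Longrightarrow>
      reports_inconsistency k \<sigma> A (last Bs) \<longleftrightarrow> \<not> (\<exists>H. winning_strategy k \<sigma> A B H)"
proof -
  note sub = last_subtarget[OF ex]
  have ex': "execution k ord \<sigma> A B Bs" "last Bs \<in> set Bs"
    using ex by (auto simp: complete_execution_def execution_def)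
  show "csp_instance \<sigma>' A' (last Bs)"
    using csp_instance_subtarget[OF sub] .
  show "satisfying_assignments \<sigma>' A' (last Bs) = satisfying_assignments \<sigma> A B"
    using satisfying_assignments_subset[OF ex'] satisfying_assignments_subtarget[OF sub k] by blast
  assume ne: "\<Union>(hyperedges \<sigma> A) \<noteq> {}"
  show "reports_inconsistency k \<sigma> A (last Bs) \<longleftrightarrow> \<not> (\<exists>H. winning_strategy k \<sigma> A B H)"
  proof
    assume rep: "reports_inconsistency k \<sigma> A (last Bs)"
    show "\<not> (\<exists>H. winning_strategy k \<sigma> A B H)"
    proof
      assume "\<exists>H. winning_strategy k \<sigma> A B H"
      then obtain H where H: "winning_strategy k \<sigma> A B H" by blast
      obtain e where "e \<in> hyperedges \<sigma> A" using ne by blast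
      then have e: "k_union k \<sigma> A e" "hyperedges \<sigma> A \<noteq> {}"
        using k k_union_of_hyperedge by auto
      have "Map.empty \<in> H"
        using winning_strategyD(1,3)[OF H] map_le_empty by blast
      \<comment> \<open>Starting from the empty map, the strategy is led to cover a whole hyperedge;
        the corresponding tuple survives, contrary to the report.\<close>
      then obtain h where "h \<in> H" "dom h = e"
        using strategy_extend[OF H _ subset_refl e] by force
      then show False
        using strategy_imp_consistent[OF H e(2) ex' e(1)] rep e(1)
        unfolding reports_inconsistency_def by blast
    qed
  next
    assume "\<not> (\<exists>H. winning_strategy k \<sigma> A B H)"
    then show "reports_inconsistency k \<sigma> A (last Bs)"
      using consistent_imp_strategy[OF ex _ _ ne k] unfolding reports_inconsistency_def by blast
  qed
qed

end

section \<open>The program\<close>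

lemma fptb_comp_lists:
  "fptb (\<lambda>z. c (list_of_tree (left z)) (list_of_tree (right z))) \<Longrightarrow> fptl l \<Longrightarrow> fptl m \<Longrightarrow>
    fptb (\<lambda>x. c (l x) (m x))"
  using fptb_comp[of "\<lambda>z. c (list_of_tree (left z)) (list_of_tree (right z))"
      "\<lambda>x. Node (tree_of_list (l x)) (tree_of_list (m x))"]
  by (simp add: fpt_intros)

text \<open>Each tuple of \<open>A\<close> is stored with the whole relation of \<open>B\<close> for
  its symbol. States of the loop have the same shape, with listings of unions as scopes.\<close>

definition constraints :: "tree \<Rightarrow> tree list" where
  "constraints x = concat (map (\<lambda>r. map (\<lambda>a. Node a (left (right (right (right r)))))
     (list_of_tree (left (right (right r))))) (list_of_tree (left (right (right x)))))"

lemma fptl_constraints [fpt_intros]: "fpt f \<Longrightarrow> fptl (\<lambda>x. constraints (f x))"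
proof -
  have "fptl constraints"
    unfolding constraints_def by (intro fpt_intros)
  then show "fpt f \<Longrightarrow> fptl (\<lambda>x. constraints (f x))" by (rule fptl_comp)
qed

text \<open>Lists of pairs stand for partial maps: \<open>compatible L L\<close> says that
  \<open>L\<close> is single-valued, and between single-valued lists compatibility is agreement on
  the common domain.\<close>

definition compatible :: "tree list \<Rightarrow> tree list \<Rightarrow> bool" where
  "compatible L M \<longleftrightarrow> (\<forall>p\<in>set L. \<forall>q\<in>set M. left p = left q \<longrightarrow> right p = right q)"

lemma fptb_compatible [fpt_intros]:
  "fptl l \<Longrightarrow> fptl m \<Longrightarrow> fptb (\<lambda>x. compatible (l x) (m x))"
  by (rule fptb_comp_lists) (unfold compatible_def, intro fpt_intros)

definition satisfiable :: "tree list \<Rightarrow> tree list \<Rightarrow> bool" where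
  "satisfiable cs L \<longleftrightarrow> (\<forall>c\<in>set cs. \<exists>t\<in>set (list_of_tree (right c)).
     compatible (map2 Node (list_of_tree (left c)) (list_of_tree t)) L)"

lemma fptb_satisfiable [fpt_intros]:
  "fptl l \<Longrightarrow> fptl m \<Longrightarrow> fptb (\<lambda>x. satisfiable (l x) (m x))"
  by (rule fptb_comp_lists) (unfold satisfiable_def, intro fpt_intros)

definition pairings :: "tree list \<Rightarrow> tree list" where
  "pairings cs = concat (map (\<lambda>c. map (\<lambda>t. tree_of_list (map2 Node (list_of_tree (left c)) (list_of_tree t)))
     (list_of_tree (right c))) cs)"

lemma fptl_pairings [fpt_intros]: "fptl l \<Longrightarrow> fptl (\<lambda>x. pairings (l x))"
  unfolding pairings_def by (intro fpt_intros)

definition assignments :: "nat \<Rightarrow> tree \<Rightarrow> tree list" where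
  "assignments k x = map tree_of_list (kcat k (map list_of_tree (pairings (constraints x))))"

lemma fptl_assignments [fpt_intros]: "fpt f \<Longrightarrow> fptl (\<lambda>x. assignments k (f x))"
  unfolding assignments_def by (intro fpt_intros)

text \<open>The inner \<open>dedup\<close> makes each listing repetition-free, the outer one keeps a
  single listing per set.\<close>

definition unions :: "nat \<Rightarrow> tree \<Rightarrow> tree list" where
  "unions k x = dedup (\<lambda>s t. set (list_of_tree s) = set (list_of_tree t))
     (map (\<lambda>u. tree_of_list (dedup (=) (list_of_tree u)))
       (map tree_of_list (kcat k (map list_of_tree (map left (constraints x))))))"

lemma fptl_unions [fpt_intros]: "fptl (\<lambda>x. unions k x)"
  unfolding unions_def by (intro fpt_intros)

definition lookup :: "tree list \<Rightarrow> tree \<Rightarrow> tree" where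
  "lookup L a = right (left (tree_of_list (filter (\<lambda>p. left p = a) L)))"

text \<open>The candidates are the same for all unions; the filter selects those with domain exactly
  \<open>u\<close>. Different choices of tuples may yield the same map, hence
  \<open>dedup\<close>.\<close>

definition tuples :: "nat \<Rightarrow> tree \<Rightarrow> tree \<Rightarrow> tree list" where
  "tuples k x u = dedup (=) (map (\<lambda>L. tree_of_list (map (lookup (list_of_tree L)) (list_of_tree u)))
     (filter (\<lambda>L. compatible (list_of_tree L) (list_of_tree L) \<and>
          set (map left (list_of_tree L)) = set (list_of_tree u) \<and>
          satisfiable (constraints x) (list_of_tree L))
        (assignments k x)))"

definition initial :: "nat \<Rightarrow> tree \<Rightarrow> tree list" where
  "initial k x = map (\<lambda>u. Node u (tree_of_list (tuples k x u))) (unions k x)"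

lemma fptl_initial [fpt_intros]: "fptl (\<lambda>x. initial k x)"
  unfolding initial_def tuples_def lookup_def by (intro fpt_intros)

definition inconsistent :: "tree list \<Rightarrow> tree list" where
  "inconsistent s = concat (map (\<lambda>p. map (\<lambda>t. Node (left p) t)
     (filter (\<lambda>t. \<not> satisfiable s (map2 Node (list_of_tree (left p)) (list_of_tree t)))
       (list_of_tree (right p)))) s)"

lemma fptl_inconsistent [fpt_intros]:
  assumes "fpt f"
  shows "fptl (\<lambda>x. inconsistent (list_of_tree (f x)))"
proof -
  have "fptl (\<lambda>x. inconsistent (list_of_tree x))"
    unfolding inconsistent_def by (intro fpt_intros)
  then show ?thesis by (rule fptl_comp[OF _ assms])
qed

text \<open>The exception for \<open>Leaf\<close>, which never occurs, keeps deletion from enlarging arbitrary trees.\<close>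

definition delete :: "tree \<Rightarrow> tree list \<Rightarrow> tree list" where
  "delete b s = map (\<lambda>p. if p = Leaf then Leaf else
     Node (left p) (tree_of_list (filter (\<lambda>t. \<not> Node (left p) t = b) (list_of_tree (right p))))) s"

lemma size_filter_le: "size (tree_of_list (filter c xs)) \<le> size (tree_of_list xs)"
  by (induction xs) auto

lemma size_map_le:
  "(\<And>t. size (f t) \<le> size t) \<Longrightarrow> size (tree_of_list (map f xs)) \<le> size (tree_of_list xs)"
  by (induction xs) (auto intro: add_mono)

lemma size_delete_le: "size (tree_of_list (delete b s)) \<le> size (tree_of_list s)"
  unfolding delete_def
proof (rule size_map_le)
  fix p
  show "size (if p = Leaf then Leaf else
      Node (left p) (tree_of_list (filter (\<lambda>t. \<not> Node (left p) t = b) (list_of_tree (right p))))) \<le> size p"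
    using size_filter_le[of "\<lambda>t. \<not> Node (left p) t = b" "list_of_tree (right p)"]
    by (cases p) auto
qed

text \<open>The accumulator is the history, newest state first, so \<open>left acc\<close> is the
  current state. A round deletes one offending tuple, as \<open>removal\<close> does. Leaving the
  history unchanged when there is none lets the loop run for a number of rounds fixed in
  advance.\<close>

definition step :: "tree \<Rightarrow> tree" where
  "step acc = (if tree_of_list (inconsistent (list_of_tree (left acc))) = Leaf then acc else
     Node (tree_of_list (delete (left (tree_of_list (inconsistent (list_of_tree (left acc)))))
       (list_of_tree (left acc)))) acc)"

lemma fpt_step [fpt_intros]:
  assumes "fpt f"
  shows "fpt (\<lambda>x. step (f x))"
proof -
  have "fpt step"
    unfolding step_def delete_def by (intro fpt_intros)
  then show ?thesis by (rule fpt_comp[OF _ assms])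
qed

lemma size_step: "size (left (step acc)) \<le> size (left acc)"
    "size (step acc) \<le> size acc + size (left acc) + 1"
  using size_delete_le[of _ "list_of_tree (left acc)"] by (auto simp: step_def)

text \<open>States never grow, so a round adds at most the size of the initial state plus
  one.\<close>

lemma size_steps:
  "size (left (foldl (\<lambda>acc h. step acc) acc ys)) \<le> size (left acc) \<and>
    size (foldl (\<lambda>acc h. step acc) acc ys) \<le> size acc + length ys * (size (left acc) + 1)"
proof (induction ys arbitrary: acc)
  case (Cons y ys)
  let ?r = "foldl (\<lambda>acc h. step acc) (step acc) ys"
  have "size ?r \<le> size (step acc) + length ys * (size (left (step acc)) + 1)"
    using Cons by blast
  also have "\<dots> \<le> (size acc + size (left acc) + 1) + length ys * (size (left acc) + 1)"
    using size_step[of acc] by (intro add_mono mult_le_mono) auto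
  finally have "size ?r \<le> size acc + length (y # ys) * (size (left acc) + 1)"
    by simp
  moreover have "size (left ?r) \<le> size (left acc)"
    using Cons[of "step acc"] size_step(1)[of acc] by linarith
  ultimately show ?case by simp
qed simp

definition run :: "nat \<Rightarrow> tree \<Rightarrow> tree" where
  "run k x = foldl (\<lambda>acc h. step acc) (Node (tree_of_list (initial k x)) Leaf) (assignments k x)"

text \<open>\<open>fpt_foldl\<close> does not apply, because a round adds a copy of part of the
  accumulator itself. The prefixes are bounded directly, through \<open>size_steps\<close>.\<close>

lemma fpt_run [fpt_intros]: "fpt (run k)"
proof -
  obtain p where p: "\<And>x. size (tree_of_list (initial k x)) \<le> poly p (size x)"
    using fpt_size[OF fpt_tree_of_list[OF fptl_initial[of k]]] by metis
  obtain q where q: "\<And>x. size (tree_of_list (assignments k x)) \<le> poly q (size x)"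
    using fpt_size[OF fpt_tree_of_list[OF fptl_assignments[OF fpt_id, of k]]] by metis
  show ?thesis
    unfolding run_def
  proof (rule fpt_foldl_bounded)
    fix x ys
    assume ys: "prefix ys (assignments k x)"
    let ?i = "tree_of_list (initial k x)"
    have len: "length ys \<le> poly q (size x)"
      using prefix_length_le[OF ys] length_le_size[of "assignments k x"] q[of x] by linarith
    have "size (foldl (\<lambda>acc h. step acc) (Node ?i Leaf) ys) \<le>
        (size ?i + 1) + length ys * (size ?i + 1)"
      using size_steps[of "Node ?i Leaf" ys] by simp
    also have "\<dots> \<le> (poly p (size x) + 1) + poly q (size x) * (poly p (size x) + 1)"
      using p[of x] len by (intro add_mono mult_le_mono) auto
    also have "\<dots> = poly ((p + 1) + q * (p + 1)) (size x)"
      by simp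
    finally show "size (foldl (\<lambda>acc h. step acc) (Node ?i Leaf) ys) \<le>
        poly ((p + 1) + q * (p + 1)) (size x)" .
  qed (intro fpt_intros)+
qed

text \<open>In each row the listing serves three times: as the code of the symbol, which is a set;
  through its length, as the unary arity; and as the only tuple of \<open>A'\<close>.\<close>

definition instance_tree :: "tree \<Rightarrow> tree \<Rightarrow> tree" where
  "instance_tree x s = tree_of_list [left x, left (right x),
     tree_of_list (map (\<lambda>p. tree_of_list [left p, tree_of_list (map (\<lambda>_. Leaf) (list_of_tree (left p))),
       tree_of_list [left p], right p]) (list_of_tree s))]"

definition trace :: "nat \<Rightarrow> tree \<Rightarrow> tree" where
  "trace k x = Node (tree_of_bool (\<forall>p\<in>set (list_of_tree (left (run k x))). right p = Leaf))
     (tree_of_list (map (instance_tree x) (rev (list_of_tree (run k x)))))"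

lemma fpt_trace: "fpt (trace k)"
proof -
  have "fpt (\<lambda>x. trace k x)"
    unfolding trace_def instance_tree_def by (intro fpt_intros)
  then show ?thesis by simp
qed

section \<open>Correctness of the program\<close>

lemma filter_map_cong:
  "(\<And>y. y \<in> set ys \<Longrightarrow> P (f y) \<longleftrightarrow> Q y) \<Longrightarrow> filter P (map f ys) = map f (filter Q ys)"
  by (induction ys) auto

text \<open>The program compares codes, the correctness proof objects. The two need to match only on
  the elements that occur, which is all that injectivity on the universes provides.\<close>

lemma dedup_map:
  assumes "\<And>a b. a \<in> set xs \<Longrightarrow> b \<in> set xs \<Longrightarrow> E (f a) (f b) \<longleftrightarrow> E' a b"
  shows "dedup E (map f xs) = map f (dedup E' xs)"
proof -
  let ?g = "\<lambda>acc h. if \<exists>y\<in>set acc. E y h then acc else h # acc"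
  let ?g' = "\<lambda>acc h. if \<exists>y\<in>set acc. E' y h then acc else h # acc"
  have "foldl ?g (map f acc) (map f ys) = map f (foldl ?g' acc ys)"
    if "set ys \<subseteq> set xs" "set acc \<subseteq> set xs" for acc ys
    using that
  proof (induction ys arbitrary: acc)
    case (Cons y ys)
    have "(\<exists>z\<in>set (map f acc). E z (f y)) \<longleftrightarrow> (\<exists>z\<in>set acc. E' z y)"
      using Cons.prems assms by (auto simp: subset_iff)
    then have "?g (map f acc) (f y) = map f (?g' acc y)"
      by simp
    moreover have "set (?g' acc y) \<subseteq> set xs"
      using Cons.prems by simp
    ultimately show ?case
      using Cons.IH[of "?g' acc y"] Cons.prems(1) by simp
  qed simp
  from this[of xs "[]"] show ?thesis
    by (simp add: dedup_def)
qed

text \<open>Presenting the equivalence as the kernel of \<open>f\<close> covers both uses: equality,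
  with \<open>f\<close> the identity, and equality of underlying sets, with
  \<open>f = set\<close>.\<close>

lemma dedup_properties:
  assumes "\<And>a b. E a b \<longleftrightarrow> f a = f b"
  shows "distinct (map f (dedup E xs))" "f ` set (dedup E xs) = f ` set xs"
    "set (dedup E xs) \<subseteq> set xs"
proof -
  let ?g = "\<lambda>acc h. if \<exists>y\<in>set acc. E y h then acc else h # acc"
  have "(distinct (map f acc) \<longrightarrow> distinct (map f (foldl ?g acc ys))) \<and>
      f ` set (foldl ?g acc ys) = f ` set acc \<union> f ` set ys \<and>
      set (foldl ?g acc ys) \<subseteq> set acc \<union> set ys" for acc ys
  proof (induction ys arbitrary: acc)
    case (Cons y ys)
    have *: "f ` set (?g acc y) = f ` set acc \<union> {f y}"
      "distinct (map f acc) \<longrightarrow> distinct (map f (?g acc y))"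
      "set (?g acc y) \<subseteq> set acc \<union> {y}"
      using assms by auto force+
    have "f ` set (foldl ?g acc (y # ys)) = f ` set acc \<union> f ` set (y # ys)"
      using Cons[of "?g acc y"] *(1) by auto
    moreover have "distinct (map f acc) \<longrightarrow> distinct (map f (foldl ?g acc (y # ys)))"
      using Cons[of "?g acc y"] *(2) by (simp only: foldl_Cons) blast
    moreover have "set (foldl ?g acc (y # ys)) \<subseteq> set acc \<union> set (y # ys)"
      using Cons[of "?g acc y"] *(3) by (simp only: foldl_Cons list.set) blast
    ultimately show ?case by blast
  qed simp
  from this[of "[]" xs] show "distinct (map f (dedup E xs))" "f ` set (dedup E xs) = f ` set xs"
    "set (dedup E xs) \<subseteq> set xs"
    by (auto simp: dedup_def)
qed

lemma dedup_eq: "distinct (dedup (=) xs)" "set (dedup (=) xs) = set xs"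
  using dedup_properties[of "(=)" "\<lambda>x. x" xs] by simp_all

lemma kcat_map: "kcat k (map (map f) xss) = map (map f) (kcat k xss)"
  by (induction k) (simp_all add: map_concat comp_def)

lemma set_kcat: "set (kcat k xss) = {concat yss | yss. length yss = k \<and> set yss \<subseteq> set xss}"
proof (induction k)
  case (Suc k)
  show ?case
  proof (intro set_eqI iffI)
    fix zs
    assume "zs \<in> set (kcat (Suc k) xss)"
    then obtain xs yss where "xs \<in> set xss" "length yss = k" "set yss \<subseteq> set xss" "zs = xs @ concat yss"
      using Suc by auto
    then show "zs \<in> {concat yss | yss. length yss = Suc k \<and> set yss \<subseteq> set xss}"
      by (intro CollectI exI[of _ "xs # yss"]) auto
  next
    fix zs
    assume "zs \<in> {concat yss | yss. length yss = Suc k \<and> set yss \<subseteq> set xss}"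
    then obtain yss where "length yss = Suc k" "set yss \<subseteq> set xss" "zs = concat yss"
      by blast
    then show "zs \<in> set (kcat (Suc k) xss)"
      using Suc by (cases yss) auto
  qed
qed auto

section \<open>Codes of lists\<close>

definition encode :: "('x \<Rightarrow> tree) \<Rightarrow> 'x list \<Rightarrow> tree" where
  "encode f xs = tree_of_list (map f xs)"

lemma list_of_encode [simp]: "list_of_tree (encode f xs) = map f xs"
  by (simp add: encode_def)

lemma encode_eq_iff:
  assumes "inj_on f X" "set xs \<subseteq> X" "set ys \<subseteq> X"
  shows "encode f xs = encode f ys \<longleftrightarrow> xs = ys"
  using assms inj_on_map_eq_map[of f xs ys] inj_on_subset[of f X "set xs \<union> set ys"]
  by (auto simp: encode_def)

lemma list_code_iff:
  assumes "\<And>x t. code x t \<longleftrightarrow> t = f x"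
  shows "list_code code xs t \<longleftrightarrow> t = encode f xs"
proof -
  have "list_all2 code xs ts \<longleftrightarrow> ts = map f xs" for ts
    using assms by (auto simp: list_all2_conv_all_nth intro: nth_equalityI)
  then show ?thesis by (auto simp: list_code_def encode_def)
qed

lemma list_code_name: "list_code (name_code f) xs t \<longleftrightarrow> t = encode f xs"
  by (rule list_code_iff) (simp add: name_code_def)

lemma list_code_list_code_name:
  "list_code (list_code (name_code f)) xs t \<longleftrightarrow> t = encode (encode f) xs"
  by (rule list_code_iff) (simp add: list_code_name)

text \<open>The code of a symbol's entry is not determined by the symbol, since its relations may be
  enumerated in any order. Along a repetition-free list the choices made can be collected into a
  function.\<close>

lemma list_code_distinct:
  assumes "list_code code xs t" "distinct xs"
  shows "\<exists>f. t = encode f xs \<and> (\<forall>x\<in>set xs. code x (f x))"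
proof -
  obtain ts where ts: "list_all2 code xs ts" "t = tree_of_list ts"
    using assms(1) by (auto simp: list_code_def)
  define f where "f x = the (map_of (zip xs ts) x)" for x
  have f: "f (xs ! i) = ts ! i" if "i < length xs" for i
    using that ts(1) assms(2) list_all2_lengthD[OF ts(1)] by (simp add: f_def map_of_zip_nth)
  then have "ts = map f xs"
    using list_all2_lengthD[OF ts(1)] by (auto intro: nth_equalityI)
  moreover have "code x (f x)" if "x \<in> set xs" for x
    using that ts(1) f by (auto simp: list_all2_conv_all_nth in_set_conv_nth)
  ultimately show ?thesis using ts(2) by (auto simp: encode_def)
qed

lemma successively_length_le:
  assumes step: "\<And>x y. I x \<Longrightarrow> R x y \<Longrightarrow> I y \<and> m y < (m x :: nat)"
  shows "successively R xs \<Longrightarrow> xs \<noteq> [] \<Longrightarrow> I (hd xs) \<Longrightarrow> length xs \<le> Suc (m (hd xs))"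
proof (induction xs rule: induct_list012)
  case (3 x y zs)
  have "R x y" "successively R (y # zs)" "I x"
    using "3.prems" by simp_all
  then have "I y" "m y < m x" "length (y # zs) \<le> Suc (m y)"
    using "3.IH"(2) step by (metis list.sel(1) list.simps(3))+
  then show ?case by simp
qed simp_all

section \<open>Bound on the number of removals\<close>

context algorithm
begin

lemma tup_inj:
  assumes "k_union k \<sigma> A U" "length bs = length (ord U)" "k_union k \<sigma> A V"
    "length cs = length (ord V)" "tup U bs = tup V cs"
  shows "U = V \<and> bs = cs"
proof -
  have UV: "U = V" using dom_tup assms by metis
  have "bs ! i = cs ! i" if "i < length bs" for i
  proof -
    have "tup U bs (ord U ! i) = Some (bs ! i)" "tup U cs (ord U ! i) = Some (cs ! i)"
      using that assms(1-4) ord[OF assms(1)] UV by (simp_all add: tup_def map_of_zip_nth)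
    then show ?thesis using assms(5) UV by (metis option.inject)
  qed
  then show ?thesis using UV assms by (auto intro: nth_equalityI)
qed

text \<open>The measure is the set \<open>M B1\<close> of partial maps given by the remaining
  tuples. A map determines its union, as its domain, and then its tuple, so every removal makes this
  subset of \<open>S\<close> strictly smaller.\<close>

lemma length_execution_le:
  assumes S: "finite S" "\<And>h. projective_hom \<sigma> A B h \<Longrightarrow> k_union k \<sigma> A (dom h) \<Longrightarrow> h \<in> S"
    and ex: "execution k ord \<sigma> A B Bs"
  shows "length Bs \<le> Suc (card S)"
proof -
  define M where "M B1 = {tup U bs | U bs. bs \<in> rel B1 U}" for B1 :: "('a set, 'b) rel_struct"
  have MS: "M B1 \<subseteq> S" if "subtarget B1" for B1
  proof
    fix h
    assume "h \<in> M B1"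
    then obtain U bs where h: "bs \<in> rel B1 U" "h = tup U bs" by (auto simp: M_def)
    show "h \<in> S"
      using S(2)[of h] subtarget_mem[OF that h(1)] dom_tup h(2) by auto
  qed
  have "length Bs \<le> Suc (card (M (hd Bs)))"
  proof (rule successively_length_le[where I = subtarget])
    fix B1 B2
    assume sub: "subtarget B1" and rem: "removal k ord \<sigma> A B1 B2"
    obtain U bs where U: "k_union k \<sigma> A U" "bs \<in> rel B1 U"
        "B2 = B1\<lparr>rel := (rel B1)(U := rel B1 U - {bs})\<rparr>"
      using removal_cases[OF rem] by metis
    note sub2 = subtarget_removal[OF sub rem]
    have "rel B2 V \<subseteq> rel B1 V" for V using U(3) by auto
    then have "M B2 \<subseteq> M B1" unfolding M_def by blast
    moreover have "tup U bs \<notin> M B2"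
    proof
      assume "tup U bs \<in> M B2"
      then obtain V cs where V: "cs \<in> rel B2 V" "tup U bs = tup V cs" by (auto simp: M_def)
      then have "U = V \<and> bs = cs"
        using tup_inj U(1,2) subtarget_mem[OF sub2 V(1)] subtarget_mem[OF sub U(2)] by blast
      then show False using V(1) U(3) by auto
    qed
    moreover have "tup U bs \<in> M B1" using U(2) by (auto simp: M_def)
    ultimately have "M B2 \<subset> M B1" by blast
    then show "subtarget B2 \<and> card (M B2) < card (M B1)"
      using sub2 MS[OF sub] S(1) by (meson finite_subset psubset_card_mono)
  next
    show "successively (removal k ord \<sigma> A) Bs" "Bs \<noteq> []" "subtarget (hd Bs)"
      using ex by (auto simp: execution_def subtarget_def)
  qed
  also have "card (M (hd Bs)) \<le> card S"
    using ex by (intro card_mono S(1) MS) (auto simp: execution_def subtarget_def)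
  finally show ?thesis by simp
qed

end

section \<open>The program on an encoded instance\<close>

text \<open>The fixed lists are the enumerations read off from the input tree. With them as
  parameters, each tree computed by the program becomes the code of an explicit list.\<close>

locale encoded_instance = csp \<sigma> A B
  for \<sigma> :: "'s rel_signature" and A :: "('s, 'a) rel_struct" and B :: "('s, 'b) rel_struct" +
  fixes k :: nat and \<gamma> :: "'s \<Rightarrow> tree" and \<alpha> :: "'a \<Rightarrow> tree" and \<beta> :: "'b \<Rightarrow> tree"
    and x :: tree and as\<^sub>A :: "'a list" and bs\<^sub>B :: "'b list" and Rs :: "'s list"
    and rel\<^sub>A :: "'s \<Rightarrow> 'a list list" and rel\<^sub>B :: "'s \<Rightarrow> 'b list list"
  assumes inj: "inj_on \<alpha> (universe A)" "inj_on \<beta> (universe B)"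
    and universes: "distinct as\<^sub>A" "set as\<^sub>A = universe A" "distinct bs\<^sub>B" "set bs\<^sub>B = universe B"
    and Rs: "set Rs = symbols \<sigma>"
    and rels: "\<And>R. R \<in> symbols \<sigma> \<Longrightarrow> set (rel\<^sub>A R) = rel A R" "\<And>R. R \<in> symbols \<sigma> \<Longrightarrow> set (rel\<^sub>B R) = rel B R"
    and x: "x = tree_of_list [encode \<alpha> as\<^sub>A, encode \<beta> bs\<^sub>B, encode (\<lambda>R. tree_of_list
      [\<gamma> R, unary (arity \<sigma> R), encode (encode \<alpha>) (rel\<^sub>A R), encode (encode \<beta>) (rel\<^sub>B R)]) Rs]"
begin

definition encode_pair :: "'a \<times> 'b \<Rightarrow> tree" where
  "encode_pair = (\<lambda>(a, b). Node (\<alpha> a) (\<beta> b))"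

definition encode_constraint :: "'a list \<times> 'b list list \<Rightarrow> tree" where
  "encode_constraint = (\<lambda>(s, ts). Node (encode \<alpha> s) (encode (encode \<beta>) ts))"

definition wf_constraint :: "'a list \<times> 'b list list \<Rightarrow> bool" where
  "wf_constraint = (\<lambda>(s, ts). set s \<subseteq> universe A \<and>
     (\<forall>t\<in>set ts. length t = length s \<and> set t \<subseteq> universe B))"

definition cs\<^sub>0 :: "('a list \<times> 'b list list) list" where
  "cs\<^sub>0 = concat (map (\<lambda>R. map (\<lambda>as. (as, rel\<^sub>B R)) (rel\<^sub>A R)) Rs)"

lemma constraints: "constraints x = map encode_constraint cs\<^sub>0"
  by (simp add: constraints_def x cs\<^sub>0_def encode_constraint_def map_concat comp_def)

lemma set_cs\<^sub>0: "set cs\<^sub>0 = {(as, rel\<^sub>B R) | as R. R \<in> symbols \<sigma> \<and> as \<in> rel A R}"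
  using Rs rels by (auto simp: cs\<^sub>0_def)

lemma wf_cs\<^sub>0: "c \<in> set cs\<^sub>0 \<Longrightarrow> wf_constraint c"
  using rel_source rel_target rels unfolding set_cs\<^sub>0 wf_constraint_def by fastforce

lemma map2_Node: "map2 Node (map \<alpha> s) (map \<beta> t) = map encode_pair (zip s t)"
  by (simp add: encode_pair_def zip_map_map comp_def case_prod_beta)

lemma compatible_encode:
  assumes "set L \<subseteq> universe A \<times> universe B" "set M \<subseteq> universe A \<times> universe B"
  shows "compatible (map encode_pair L) (map encode_pair M) \<longleftrightarrow>
    (\<forall>(a, b)\<in>set L. \<forall>(a', b')\<in>set M. a = a' \<longrightarrow> b = b')"
proof -
  have "(left (encode_pair p) = left (encode_pair q) \<longrightarrow> right (encode_pair p) = right (encode_pair q))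
      \<longleftrightarrow> (fst p = fst q \<longrightarrow> snd p = snd q)" if "p \<in> set L" "q \<in> set M" for p q
  proof -
    have "fst p \<in> universe A" "fst q \<in> universe A" "snd p \<in> universe B" "snd q \<in> universe B"
      using that assms by auto
    then show ?thesis
      using inj_on_eq_iff[OF inj(1)] inj_on_eq_iff[OF inj(2)]
      by (simp add: encode_pair_def case_prod_beta)
  qed
  then show ?thesis
    by (simp add: compatible_def case_prod_beta)
qed

text \<open>Pairings of overlapping hyperedges repeat pairs when concatenated, so only the set of
  pairs is compared with the graph of \<open>h\<close>.\<close>

definition graph_of :: "('a \<times> 'b) list \<Rightarrow> ('a \<rightharpoonup> 'b) \<Rightarrow> bool" where
  "graph_of L h \<longleftrightarrow> set L \<subseteq> universe A \<times> universe B \<and> (\<forall>a b. (a, b) \<in> set L \<longleftrightarrow> h a = Some b)"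

lemma graph_of_map_of:
  assumes "graph_of L h"
  shows "map_of L = h"
proof
  fix a
  show "map_of L a = h a"
  proof (cases "map_of L a")
    case None
    then have "\<forall>b. (a, b) \<notin> set L" by (auto simp: map_of_eq_None_iff image_iff)
    then show ?thesis using assms None unfolding graph_of_def by (metis option.exhaust)
  next
    case (Some b)
    then show ?thesis using assms map_of_SomeD unfolding graph_of_def by metis
  qed
qed

text \<open>Stated for arbitrary constraints because it serves twice: with \<open>cs\<^sub>0\<close>
  for the test against the input, and with a state for the test in the removal loop.\<close>

lemma satisfiable_encode:
  assumes cs: "\<And>c. c \<in> set cs \<Longrightarrow> wf_constraint c" and L: "graph_of L h"
  shows "satisfiable (map encode_constraint cs) (map encode_pair L) \<longleftrightarrow>
    (\<forall>(s, ts)\<in>set cs. \<exists>t\<in>set ts. \<forall>i<length s. s ! i \<in> dom h \<longrightarrow> h (s ! i) = Some (t ! i))"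
proof -
  have "compatible (map2 Node (map \<alpha> s) (map \<beta> t)) (map encode_pair L) \<longleftrightarrow>
      (\<forall>i<length s. s ! i \<in> dom h \<longrightarrow> h (s ! i) = Some (t ! i))"
    if c: "(s, ts) \<in> set cs" "t \<in> set ts" for s t ts
  proof -
    have st: "length t = length s" "set s \<subseteq> universe A" "set t \<subseteq> universe B"
      using cs[OF c(1)] c(2) by (auto simp: wf_constraint_def)
    have "set (zip s t) \<subseteq> universe A \<times> universe B"
      using st by (auto dest: set_zip_leftD set_zip_rightD)
    then have "compatible (map2 Node (map \<alpha> s) (map \<beta> t)) (map encode_pair L) \<longleftrightarrow>
        (\<forall>(a, b)\<in>set (zip s t). \<forall>(a', b')\<in>set L. a = a' \<longrightarrow> b = b')"
      using L unfolding map2_Node graph_of_def by (intro compatible_encode) auto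
    also have "\<dots> \<longleftrightarrow> (\<forall>(a, b)\<in>set (zip s t). a \<in> dom h \<longrightarrow> h a = Some b)"
      using L by (fastforce simp: graph_of_def)
    also have "\<dots> \<longleftrightarrow> (\<forall>i<length s. s ! i \<in> dom h \<longrightarrow> h (s ! i) = Some (t ! i))"
      using st(1) by (fastforce simp: set_zip)
    finally show ?thesis .
  qed
  then show ?thesis
    by (fastforce simp: satisfiable_def encode_constraint_def)
qed

lemma graph_of_dom: "graph_of L h \<Longrightarrow> dom h \<subseteq> universe A \<and> ran h \<subseteq> universe B"
  by (fastforce simp: graph_of_def ran_def)

lemma satisfiable_constraints:
  assumes "graph_of L h"
  shows "satisfiable (constraints x) (map encode_pair L) \<longleftrightarrow> projective_hom \<sigma> A B h"
proof -
  have "satisfiable (constraints x) (map encode_pair L) \<longleftrightarrow>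
      (\<forall>R\<in>symbols \<sigma>. \<forall>as\<in>rel A R. \<exists>t\<in>rel B R. \<forall>i<length as. as ! i \<in> dom h \<longrightarrow> h (as ! i) = Some (t ! i))"
  proof -
    have "(\<forall>(s, ts)\<in>set cs\<^sub>0. P s (set ts)) \<longleftrightarrow> (\<forall>R\<in>symbols \<sigma>. \<forall>as\<in>rel A R. P as (rel B R))" for P
      using rels by (force simp: set_cs\<^sub>0)
    moreover have "satisfiable (constraints x) (map encode_pair L) \<longleftrightarrow>
        (\<forall>(s, ts)\<in>set cs\<^sub>0. \<exists>t\<in>set ts. \<forall>i<length s. s ! i \<in> dom h \<longrightarrow> h (s ! i) = Some (t ! i))"
      unfolding constraints by (rule satisfiable_encode[OF _ assms]) (rule wf_cs\<^sub>0)
    ultimately show ?thesis by (rule ssubst[rotated])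
  qed
  then show ?thesis
    using graph_of_dom[OF assms] rel_source by (auto simp: projective_hom_def)
qed

definition us :: "'a list list" where
  "us = dedup (\<lambda>s t. set s = set t) (map (dedup (=)) (kcat k (map fst cs\<^sub>0)))"

definition Ls :: "('a \<times> 'b) list list" where
  "Ls = kcat k (concat (map (\<lambda>(s, ts). map (zip s) ts) cs\<^sub>0))"

lemma hyperedges_cs\<^sub>0: "hyperedges \<sigma> A = (set \<circ> fst) ` set cs\<^sub>0"
  unfolding set_cs\<^sub>0 hyperedges_def by force

lemma set_kcat_scopes: "set ` set (kcat k (map fst cs\<^sub>0)) = {U. k_union k \<sigma> A U}"
proof (intro set_eqI iffI)
  fix U
  assume "U \<in> set ` set (kcat k (map fst cs\<^sub>0))"
  then obtain yss where "length yss = k" "set yss \<subseteq> fst ` set cs\<^sub>0" "U = set (concat yss)"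
    by (auto simp: set_kcat)
  then show "U \<in> {U. k_union k \<sigma> A U}"
    unfolding k_union_def hyperedges_cs\<^sub>0 mem_Collect_eq
    by (intro exI[of _ "map set yss"]) (auto simp: image_comp[symmetric])
next
  fix U
  assume "U \<in> {U. k_union k \<sigma> A U}"
  then obtain es where es: "length es = k" "set es \<subseteq> set ` fst ` set cs\<^sub>0" "U = \<Union>(set es)"
    by (auto simp: k_union_def hyperedges_cs\<^sub>0 image_comp)
  then have "\<forall>e\<in>set es. \<exists>s\<in>fst ` set cs\<^sub>0. e = set s" by blast
  then obtain f where f: "\<And>e. e \<in> set es \<Longrightarrow> f e \<in> fst ` set cs\<^sub>0 \<and> e = set (f e)" by metis
  have "concat (map f es) \<in> set (kcat k (map fst cs\<^sub>0))"
    using es f unfolding set_kcat by (intro CollectI exI[of _ "map f es"]) auto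
  moreover have "set (concat (map f es)) = U" using f es(3) by auto
  ultimately show "U \<in> set ` set (kcat k (map fst cs\<^sub>0))" by blast
qed

lemma us:
  shows "set ` set us = {U. k_union k \<sigma> A U}" "distinct (map set us)" "u \<in> set us \<Longrightarrow> distinct u"
proof -
  let ?d = "map (dedup (=)) (kcat k (map fst cs\<^sub>0))"
  note d = dedup_properties[of "\<lambda>s t. set s = set t" set ?d, folded us_def]
  show "distinct (map set us)" using d(1) by simp
  have "set ` set ?d = {U. k_union k \<sigma> A U}"
    unfolding set_kcat_scopes[symmetric] by (simp add: image_image dedup_eq)
  then show "set ` set us = {U. k_union k \<sigma> A U}" using d(2) by simp
  show "distinct u" if "u \<in> set us"
    using d(3) that dedup_eq(1) by auto
qed

lemma us_subset: "u \<in> set us \<Longrightarrow> set u \<subseteq> universe A"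
proof -
  assume "u \<in> set us"
  then have "k_union k \<sigma> A (set u)" using us(1) by blast
  then show ?thesis
    using rel_source unfolding k_union_def hyperedges_def by fastforce
qed

lemma unions: "unions k x = map (encode \<alpha>) us"
proof -
  let ?K = "kcat k (map fst cs\<^sub>0)"
  have F: "map list_of_tree (map left (constraints x)) = map (map \<alpha>) (map fst cs\<^sub>0)"
    by (simp add: constraints encode_constraint_def comp_def case_prod_beta)
  have 1: "map tree_of_list (kcat k (map list_of_tree (map left (constraints x)))) =
      map (encode \<alpha>) ?K"
    unfolding F kcat_map by (simp add: encode_def comp_def)
  have K: "set u \<subseteq> universe A" if "u \<in> set ?K" for u
  proof -
    have "k_union k \<sigma> A (set u)" using that set_kcat_scopes by blast
    then show ?thesis
      using rel_source unfolding k_union_def hyperedges_def by fastforce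
  qed
  have "tree_of_list (dedup (=) (map \<alpha> u)) = encode \<alpha> (dedup (=) u)" if "u \<in> set ?K" for u
  proof -
    have "dedup (=) (map \<alpha> u) = map \<alpha> (dedup (=) u)"
      using K[OF that] inj_on_eq_iff[OF inj(1)] by (intro dedup_map) (auto simp: subset_iff)
    then show ?thesis by (simp add: encode_def)
  qed
  then have 2: "map (\<lambda>u. tree_of_list (dedup (=) (list_of_tree u))) (map (encode \<alpha>) ?K) =
      map (encode \<alpha>) (map (dedup (=)) ?K)"
    by (simp add: comp_def)
  have "unions k x = dedup (\<lambda>s t. set (list_of_tree s) = set (list_of_tree t))
      (map (encode \<alpha>) (map (dedup (=)) ?K))"
    unfolding unions_def 1 2 by (rule refl)
  also have "\<dots> = map (encode \<alpha>) us"
    unfolding us_def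
  proof (rule dedup_map)
    fix a b
    assume "a \<in> set (map (dedup (=)) ?K)" "b \<in> set (map (dedup (=)) ?K)"
    then have "set a \<subseteq> universe A" "set b \<subseteq> universe A"
      using K by (auto simp: dedup_eq subset_iff)
    then show "set (list_of_tree (encode \<alpha> a)) = set (list_of_tree (encode \<alpha> b)) \<longleftrightarrow> set a = set b"
      using inj_on_image_eq_iff[OF inj(1)] by simp
  qed
  finally show ?thesis .
qed

lemma assignments: "assignments k x = map (encode encode_pair) Ls"
proof -
  have "map list_of_tree (pairings (map encode_constraint cs)) =
      map (map encode_pair) (concat (map (\<lambda>(s, ts). map (zip s) ts) cs))" for cs
  proof (induction cs)
    case (Cons c cs)
    obtain s ts where "c = (s, ts)" by (cases c)
    then show ?case
      using Cons by (simp add: pairings_def encode_constraint_def comp_def map2_Node)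
  qed (simp add: pairings_def)
  from this[of cs\<^sub>0] show ?thesis
    unfolding assignments_def Ls_def constraints by (simp only: kcat_map) (simp add: encode_def comp_def)
qed

lemma Ls_subset:
  assumes "L \<in> set Ls"
  shows "set L \<subseteq> universe A \<times> universe B"
proof
  fix p
  assume "p \<in> set L"
  then obtain s ts t where st: "(s, ts) \<in> set cs\<^sub>0" "t \<in> set ts" "p \<in> set (zip s t)"
    using assms unfolding Ls_def set_kcat by fastforce
  then show "p \<in> universe A \<times> universe B"
    using wf_cs\<^sub>0[OF st(1)] set_zip_leftD[of "fst p" "snd p" s t] set_zip_rightD[of "fst p" "snd p" s t]
    by (cases p) (auto simp: wf_constraint_def)
qed

text \<open>Choosing one tuple for each of the \<open>k\<close> hyperedges whose union is the domain determines a
  projective homomorphism.\<close>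

lemma graph_in_Ls:
  assumes h: "projective_hom \<sigma> A B h" "k_union k \<sigma> A (dom h)"
  shows "\<exists>L\<in>set Ls. graph_of L h"
proof -
  obtain es where es: "length es = k" "set es \<subseteq> hyperedges \<sigma> A" "dom h = \<Union>(set es)"
    using h(2) by (auto simp: k_union_def)
  have "\<exists>z. z \<in> set (concat (map (\<lambda>(s, ts). map (zip s) ts) cs\<^sub>0)) \<and>
      set z = {(a, b). a \<in> e \<and> h a = Some b}" if e: "e \<in> set es" for e
  proof -
    obtain R as where R: "R \<in> symbols \<sigma>" "as \<in> rel A R" "e = set as"
      using e es(2) by (auto simp: hyperedges_def)
    obtain bs where bs: "bs \<in> rel B R"
        "\<forall>i<arity \<sigma> R. as ! i \<in> dom h \<longrightarrow> h (as ! i) = Some (bs ! i)"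
      using h(1) R unfolding projective_hom_def by blast
    \<comment> \<open>As the scope lies inside the domain, the witness \<open>bs\<close> is forced
      to be the image of \<open>as\<close> under \<open>h\<close>, and pairing the two gives the
      graph of \<open>h\<close> on \<open>e\<close>.\<close>
    have "set as \<subseteq> dom h" using e R(3) es(3) by auto
    then have "h (as ! i) = Some (bs ! i)" if "i < length as" for i
      using bs(2) rel_source[OF R(1,2)] that nth_mem by (metis subsetD)
    then have "set (zip as bs) = {(a, b). a \<in> e \<and> h a = Some b}"
    proof -
      assume h_nth: "\<And>i. i < length as \<Longrightarrow> h (as ! i) = Some (bs ! i)"
      have len: "length as = length bs"
        using rel_source[OF R(1,2)] rel_target[OF R(1) bs(1)] by simp
      show ?thesis
      proof (intro set_eqI iffI)
        fix p
        assume "p \<in> set (zip as bs)"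
        then show "p \<in> {(a, b). a \<in> e \<and> h a = Some b}"
          using h_nth len R(3) by (auto simp: set_zip)
      next
        fix p
        assume p: "p \<in> {(a, b). a \<in> e \<and> h a = Some b}"
        then obtain i where "i < length as" "fst p = as ! i"
          using R(3) by (auto simp: in_set_conv_nth)
        then show "p \<in> set (zip as bs)"
          using p h_nth[of i] len by (auto simp: set_zip)
      qed
    qed
    moreover have "zip as bs \<in> set (concat (map (\<lambda>(s, ts). map (zip s) ts) cs\<^sub>0))"
    proof -
      have "(as, rel\<^sub>B R) \<in> set cs\<^sub>0" "bs \<in> set (rel\<^sub>B R)"
        using R bs(1) rels by (auto simp: set_cs\<^sub>0)
      then show ?thesis by force
    qed
    ultimately show ?thesis by blast
  qed
  then have "\<exists>f. \<forall>e\<in>set es. f e \<in> set (concat (map (\<lambda>(s, ts). map (zip s) ts) cs\<^sub>0)) \<and>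
      set (f e) = {(a, b). a \<in> e \<and> h a = Some b}"
    by (intro bchoice ballI)
  then obtain f where "\<forall>e\<in>set es. f e \<in> set (concat (map (\<lambda>(s, ts). map (zip s) ts) cs\<^sub>0)) \<and>
      set (f e) = {(a, b). a \<in> e \<and> h a = Some b}" ..
  then have f: "\<And>e. e \<in> set es \<Longrightarrow> f e \<in> set (concat (map (\<lambda>(s, ts). map (zip s) ts) cs\<^sub>0))"
      "\<And>e. e \<in> set es \<Longrightarrow> set (f e) = {(a, b). a \<in> e \<and> h a = Some b}"
    by (simp_all only:)
  have L: "concat (map f es) \<in> set Ls"
    unfolding Ls_def set_kcat
  proof (intro CollectI exI[of _ "map f es"] conjI subsetI)
    fix z
    assume "z \<in> set (map f es)"
    then obtain e where "e \<in> set es" "z = f e" by auto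
    then show "z \<in> set (concat (map (\<lambda>(s, ts). map (zip s) ts) cs\<^sub>0))"
      using f(1) by (simp only:)
  qed (use es(1) in auto)
  have "set (concat (map f es)) = {(a, b). a \<in> dom h \<and> h a = Some b}"
    using f(2) es(3) by simp blast
  then have "graph_of (concat (map f es)) h"
    using Ls_subset[OF L] by (auto simp: graph_of_def)
  then show ?thesis using L by blast
qed

text \<open>A list enumerating the graph of \<open>h\<close> gives back \<open>h\<close> through
  \<open>map_of\<close>, so at most \<open>length Ls\<close> maps are relevant; the initial
  structure accounts for the successor. The listing stays arbitrary because every execution has to
  be bounded.\<close>

lemma length_execution:
  assumes "listing k \<sigma> A ord" "execution k ord \<sigma> A B Bs"
  shows "length Bs \<le> Suc (length Ls)"
proof -
  interpret algorithm \<sigma> A B k ord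
    by unfold_locales (rule csp assms)+
  have "length Bs \<le> Suc (card (map_of ` set Ls))"
    using graph_in_Ls graph_of_map_of by (intro length_execution_le assms) (auto, metis imageI)
  also have "card (map_of ` set Ls) \<le> length Ls"
    by (meson card_image_le card_length finite_set order_trans)
  finally show ?thesis by simp
qed

text \<open>The listing implicit in the program: each union is listed by the representative that
  \<open>dedup\<close> kept. The inverse is unambiguous because no two members of \<open>us\<close>
  have the same set.\<close>

definition ord :: "'a set \<Rightarrow> 'a list" where
  "ord = inv_into (set us) set"

lemma ord_set: "u \<in> set us \<Longrightarrow> ord (set u) = u"
  using us(2) by (simp add: ord_def distinct_map)

lemma listing_ord: "listing k \<sigma> A ord"
  unfolding listing_def
proof (intro allI impI)
  fix U
  assume "k_union k \<sigma> A U"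
  then obtain u where "u \<in> set us" "U = set u" using us(1) by blast
  then show "distinct (ord U) \<and> set (ord U) = U" using us(3) ord_set by simp
qed

sublocale algorithm \<sigma> A B k ord
  by unfold_locales (rule csp listing_ord)+

section \<open>The initial target structure\<close>

lemma k_union_us: "u \<in> set us \<Longrightarrow> k_union k \<sigma> A (set u)"
  using us(1) by blast

lemma graph_of_tup:
  assumes "u \<in> set us" "length t = length u" "set t \<subseteq> universe B"
  shows "graph_of (zip u t) (tup (set u) t)"
  using assms us_subset[OF assms(1)] us(3)[OF assms(1)] ord_set[OF assms(1)]
  by (auto simp: graph_of_def tup_def dest: set_zip_leftD set_zip_rightD)

definition tuples\<^sub>0 :: "'a list \<Rightarrow> 'b list list" where
  "tuples\<^sub>0 u = dedup (=) (map (\<lambda>L. map (\<lambda>a. the (map_of L a)) u)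
     (filter (\<lambda>L. (\<forall>(a, b)\<in>set L. \<forall>(a', b')\<in>set L. a = a' \<longrightarrow> b = b') \<and> fst ` set L = set u \<and>
       satisfiable (constraints x) (map encode_pair L)) Ls))"

lemma lookup_encode:
  assumes "set L \<subseteq> universe A \<times> universe B" "a \<in> fst ` set L"
  shows "lookup (map encode_pair L) (\<alpha> a) = \<beta> (the (map_of L a))"
  using assms
proof (induction L)
  case (Cons p L)
  obtain a' b where p: "p = (a', b)" by (cases p)
  have "a \<in> universe A" "a' \<in> universe A" using Cons.prems p by auto
  then have "\<alpha> a' = \<alpha> a \<longleftrightarrow> a' = a" using inj_on_eq_iff[OF inj(1)] by blast
  then show ?case
    using Cons p by (auto simp: lookup_def encode_pair_def)
qed simp

lemma tuples:
  assumes u: "u \<in> set us"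
  shows "tuples k x (encode \<alpha> u) = map (encode \<beta>) (tuples\<^sub>0 u)"
proof -
  let ?P = "\<lambda>L. (\<forall>(a, b)\<in>set L. \<forall>(a', b')\<in>set L. a = a' \<longrightarrow> b = b') \<and> fst ` set L = set u \<and>
       satisfiable (constraints x) (map encode_pair L)"
  let ?Q = "\<lambda>L. compatible (list_of_tree L) (list_of_tree L) \<and>
          set (map left (list_of_tree L)) = set (list_of_tree (encode \<alpha> u)) \<and>
          satisfiable (constraints x) (list_of_tree L)"
  have "?Q (encode encode_pair L) \<longleftrightarrow> ?P L" if "L \<in> set Ls" for L
  proof -
    note L = Ls_subset[OF that]
    have "set (map left (map encode_pair L)) = \<alpha> ` fst ` set L"
      by (auto simp: encode_pair_def image_iff) force+
    moreover have "fst ` set L \<subseteq> universe A" using L by auto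
    ultimately have "set (map left (map encode_pair L)) = \<alpha> ` set u \<longleftrightarrow> fst ` set L = set u"
      using inj_on_image_eq_iff[OF inj(1)] us_subset[OF u] by simp
    then show ?thesis
      using compatible_encode[OF L L] by simp
  qed
  then have "filter ?Q (assignments k x) = map (encode encode_pair) (filter ?P Ls)"
    unfolding assignments by (rule filter_map_cong)
  moreover have "tree_of_list (map (lookup (map encode_pair L)) (map \<alpha> u)) =
      encode \<beta> (map (\<lambda>a. the (map_of L a)) u)" if "L \<in> set Ls" "fst ` set L = set u" for L
    using lookup_encode[OF Ls_subset[OF that(1)]] that(2) by (simp add: encode_def)
  ultimately have "map (\<lambda>L. tree_of_list (map (lookup (list_of_tree L)) (list_of_tree (encode \<alpha> u))))
      (filter ?Q (assignments k x)) =
      map (encode \<beta>) (map (\<lambda>L. map (\<lambda>a. the (map_of L a)) u) (filter ?P Ls))"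
    by simp
  then have "tuples k x (encode \<alpha> u) =
      dedup (=) (map (encode \<beta>) (map (\<lambda>L. map (\<lambda>a. the (map_of L a)) u) (filter ?P Ls)))"
    unfolding tuples_def by (simp only:)
  also have "\<dots> = map (encode \<beta>) (tuples\<^sub>0 u)"
    unfolding tuples\<^sub>0_def
  proof (rule dedup_map)
    have carrier: "set t \<subseteq> universe B"
      if t: "t \<in> set (map (\<lambda>L. map (\<lambda>a. the (map_of L a)) u) (filter ?P Ls))" for t
    proof -
      obtain L where L: "L \<in> set Ls" "fst ` set L = set u" "t = map (\<lambda>a. the (map_of L a)) u"
        using t by auto
      have "the (map_of L a) \<in> universe B" if a: "a \<in> set u" for a
      proof -
        obtain b where "map_of L a = Some b"
          using a L(2) by (cases "map_of L a") (auto simp: map_of_eq_None_iff)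
        then show ?thesis using Ls_subset[OF L(1)] map_of_SomeD by fastforce
      qed
      then show ?thesis using L(3) by auto
    qed
    show "encode \<beta> a = encode \<beta> b \<longleftrightarrow> a = b"
      if "a \<in> set (map (\<lambda>L. map (\<lambda>a. the (map_of L a)) u) (filter ?P Ls))"
        "b \<in> set (map (\<lambda>L. map (\<lambda>a. the (map_of L a)) u) (filter ?P Ls))" for a b
      using encode_eq_iff[OF inj(2)] carrier that by blast
  qed
  finally show ?thesis .
qed

lemma set_tuples\<^sub>0:
  assumes u: "u \<in> set us"
  shows "set (tuples\<^sub>0 u) = rel B\<^sub>0 (set u)"
proof (intro set_eqI iffI)
  fix t
  assume "t \<in> set (tuples\<^sub>0 u)"
  then obtain L where L: "L \<in> set Ls" "\<forall>(a, b)\<in>set L. \<forall>(a', b')\<in>set L. a = a' \<longrightarrow> b = b'"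
      "fst ` set L = set u" "satisfiable (constraints x) (map encode_pair L)"
      "t = map (\<lambda>a. the (map_of L a)) u"
    by (auto simp: tuples\<^sub>0_def dedup_eq)
  \<comment> \<open>Single-valuedness makes \<open>L\<close> the graph of \<open>map_of L\<close>.
    In general \<open>map_of\<close> would see only the first pair of each element, but
    \<open>satisfiable\<close> all of them.\<close>
  have "(a, b) \<in> set L \<longleftrightarrow> map_of L a = Some b" for a b
  proof
    assume ab: "(a, b) \<in> set L"
    then obtain b' where "map_of L a = Some b'"
      by (cases "map_of L a") (auto simp: map_of_eq_None_iff image_iff)
    then show "map_of L a = Some b" using ab L(2) map_of_SomeD by fastforce
  qed (rule map_of_SomeD)
  then have g: "graph_of L (map_of L)"
    using Ls_subset[OF L(1)] by (simp add: graph_of_def)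
  have "dom (map_of L) = set u"
    using L(3) by (simp add: dom_map_of_conv_image_fst)
  then have "tup (set u) t = map_of L"
    using tup_the[OF k_union_us[OF u], of "map_of L"] L(5) ord_set[OF u] by (simp add: comp_def)
  moreover have "projective_hom \<sigma> A B (map_of L)"
    using satisfiable_constraints[OF g] L(4) by blast
  ultimately show "t \<in> rel B\<^sub>0 (set u)"
    using k_union_us[OF u] ord_set[OF u] L(5) by (simp add: mem_target_iff)
next
  fix t
  assume "t \<in> rel B\<^sub>0 (set u)"
  then have t: "length t = length u" "projective_hom \<sigma> A B (tup (set u) t)"
    using mem_target_iff ord_set[OF u] by auto
  let ?h = "tup (set u) t"
  have dom: "dom ?h = set u"
    using dom_tup[OF k_union_us[OF u]] t(1) ord_set[OF u] by simp
  \<comment> \<open>Completeness of the candidates: a projective homomorphism whose domain is a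
    union always occurs among them.\<close>
  then obtain L where L: "L \<in> set Ls" "graph_of L ?h"
    using graph_in_Ls[OF t(2)] k_union_us[OF u] by auto
  have "the (?h (u ! i)) = t ! i" if "i < length u" for i
    using that t(1) us(3)[OF u] ord_set[OF u] by (simp add: tup_def map_of_zip_nth)
  then have "t = map (\<lambda>a. the (map_of L a)) u"
    using t(1) graph_of_map_of[OF L(2)] by (auto intro: nth_equalityI)
  moreover have "\<forall>(a, b)\<in>set L. \<forall>(a', b')\<in>set L. a = a' \<longrightarrow> b = b'"
    using L(2) by (auto simp: graph_of_def)
  moreover have "fst ` set L = set u"
    using dom graph_of_map_of[OF L(2)] dom_map_of_conv_image_fst by metis
  moreover have "satisfiable (constraints x) (map encode_pair L)"
    using satisfiable_constraints[OF L(2)] t(2) by blast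
  ultimately show "t \<in> set (tuples\<^sub>0 u)"
    using L(1) by (auto simp: tuples\<^sub>0_def dedup_eq)
qed

section \<open>States of the loop and executions\<close>

definition encode_state :: "('a list \<Rightarrow> 'b list list) \<Rightarrow> tree" where
  "encode_state T = encode (\<lambda>u. encode_constraint (u, T u)) us"

text \<open>The simulation relation between program and algorithm. Distinctness is included because
  codes of sets admit no repetition.\<close>

definition represents :: "('a list \<Rightarrow> 'b list list) \<Rightarrow> ('a set, 'b) rel_struct \<Rightarrow> bool" where
  "represents T B1 \<longleftrightarrow> subtarget B1 \<and> (\<forall>u\<in>set us. distinct (T u) \<and> set (T u) = rel B1 (set u))"

lemma represents_mem:
  assumes "represents T B1" "u \<in> set us" "t \<in> set (T u)"
  shows "t \<in> rel B1 (set u)" "length t = length u" "set t \<subseteq> universe B"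
proof -
  have sub: "subtarget B1" and "t \<in> rel B1 (set u)"
    using assms by (auto simp: represents_def)
  then show "t \<in> rel B1 (set u)" "length t = length u" "set t \<subseteq> universe B"
    using subtarget_mem(2)[OF sub] subtarget_set[OF sub] ord_set[OF assms(2)] by fastforce+
qed

lemma initial:
  shows "tree_of_list (initial k x) = encode_state tuples\<^sub>0" "represents tuples\<^sub>0 B\<^sub>0"
proof -
  show "tree_of_list (initial k x) = encode_state tuples\<^sub>0"
    by (simp add: initial_def unions encode_state_def encode_def[of _ us] encode_constraint_def
        tuples encode_def[of "encode \<beta>"] comp_def)
  show "represents tuples\<^sub>0 B\<^sub>0"
    using set_tuples\<^sub>0 by (auto simp: represents_def subtarget_def tuples\<^sub>0_def dedup_eq(1))
qed

text \<open>A state is itself a list of constraints, with unions as scopes and the remaining tuples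
  as relations, so the general fact on \<open>satisfiable\<close> applies; distinct listings turn
  positions into elements.\<close>

lemma satisfiable_state:
  assumes T: "represents T B1" and u: "u \<in> set us" "t \<in> set (T u)"
  shows "satisfiable (list_of_tree (encode_state T)) (map encode_pair (zip u t)) \<longleftrightarrow>
    projective_hom \<sigma>' A' B1 (tup (set u) t)"
proof -
  let ?h = "tup (set u) t"
  have sub: "subtarget B1" using T by (simp add: represents_def)
  have g: "graph_of (zip u t) ?h"
    using graph_of_tup[OF u(1)] represents_mem[OF T u] by blast
  have eq: "list_of_tree (encode_state T) = map encode_constraint (map (\<lambda>u. (u, T u)) us)"
    by (simp add: encode_state_def comp_def)
  have wf: "wf_constraint c" if "c \<in> set (map (\<lambda>u. (u, T u)) us)" for c
    using that us_subset represents_mem(2,3)[OF T] unfolding wf_constraint_def by fastforce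
  have "satisfiable (list_of_tree (encode_state T)) (map encode_pair (zip u t)) \<longleftrightarrow>
      (\<forall>v\<in>set us. \<exists>t'\<in>rel B1 (set v). \<forall>i<length v. v ! i \<in> dom ?h \<longrightarrow> ?h (v ! i) = Some (t' ! i))"
  proof -
    have "satisfiable (list_of_tree (encode_state T)) (map encode_pair (zip u t)) \<longleftrightarrow>
        (\<forall>(s, ts)\<in>set (map (\<lambda>u. (u, T u)) us). \<exists>t'\<in>set ts. \<forall>i<length s.
          s ! i \<in> dom ?h \<longrightarrow> ?h (s ! i) = Some (t' ! i))"
      unfolding eq by (rule satisfiable_encode[OF _ g]) (rule wf)
    then show ?thesis using T by (simp add: represents_def)
  qed
  also have "\<dots> \<longleftrightarrow> (\<forall>v\<in>set us. \<exists>t'\<in>rel B1 (set v). \<forall>a\<in>set v \<inter> dom ?h. ?h a = tup (set v) t' a)"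
  proof (intro ball_cong bex_cong refl)
    fix v t'
    assume v: "v \<in> set us" "t' \<in> rel B1 (set v)"
    then show "(\<forall>i<length v. v ! i \<in> dom ?h \<longrightarrow> ?h (v ! i) = Some (t' ! i)) \<longleftrightarrow>
        (\<forall>a\<in>set v \<inter> dom ?h. ?h a = tup (set v) t' a)"
      using agree_nth_iff[OF us(3)[OF v(1)], of t' ?h] subtarget_mem(2)[OF sub v(2)] ord_set[OF v(1)]
      by (simp add: tup_def)
  qed
  also have "\<dots> \<longleftrightarrow> (\<forall>U\<in>set ` set us. \<exists>t'\<in>rel B1 U. \<forall>a\<in>U \<inter> dom ?h. ?h a = tup U t' a)"
    by blast
  also have "\<dots> \<longleftrightarrow> projective_hom \<sigma>' A' B1 ?h"
    unfolding us(1) projective_hom_union_iff[OF sub] using graph_of_dom[OF g] by blast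
  finally show ?thesis .
qed

lemma inconsistent:
  assumes T: "represents T B1"
  shows "set (inconsistent (list_of_tree (encode_state T))) =
    {Node (encode \<alpha> u) (encode \<beta> t) | u t. u \<in> set us \<and> t \<in> set (T u) \<and>
      \<not> projective_hom \<sigma>' A' B1 (tup (set u) t)}" (is "?I = _")
proof -
  let ?s = "list_of_tree (encode_state T)"
  have s: "set ?s = (\<lambda>u. Node (encode \<alpha> u) (encode (encode \<beta>) (T u))) ` set us"
    by (auto simp: encode_state_def encode_constraint_def)
  have "?I = {Node (encode \<alpha> u) (encode \<beta> t) | u t. u \<in> set us \<and> t \<in> set (T u) \<and>
      \<not> satisfiable ?s (map encode_pair (zip u t))}"
    unfolding inconsistent_def using s by (auto simp: map2_Node) blast
  then show ?thesis using satisfiable_state[OF T] by auto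
qed

text \<open>Filtering by equality of codes hits only the intended tuple, because codes of listings
  and of tuples are injective on lists over the universes.\<close>

lemma delete:
  assumes T: "represents T B1" and u: "u \<in> set us" "t \<in> set (T u)"
  shows "tree_of_list (delete (Node (encode \<alpha> u) (encode \<beta> t)) (list_of_tree (encode_state T))) =
    encode_state (\<lambda>v. filter (\<lambda>t'. \<not> (v = u \<and> t' = t)) (T v))"
proof -
  have "filter (\<lambda>t'. \<not> Node (encode \<alpha> v) t' = Node (encode \<alpha> u) (encode \<beta> t)) (map (encode \<beta>) (T v)) =
      map (encode \<beta>) (filter (\<lambda>t'. \<not> (v = u \<and> t' = t)) (T v))" if v: "v \<in> set us" for v
  proof -
    have "encode \<alpha> v = encode \<alpha> u \<longleftrightarrow> v = u"
      using encode_eq_iff[OF inj(1)] us_subset u(1) v by blast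
    moreover have "encode \<beta> t' = encode \<beta> t \<longleftrightarrow> t' = t" if "t' \<in> set (T v)" for t'
      using encode_eq_iff[OF inj(2)] represents_mem(3)[OF T] u v that by blast
    ultimately show ?thesis
      by (intro filter_map_cong) auto
  qed
  then show ?thesis
    by (simp add: delete_def encode_state_def encode_def[of _ us] encode_constraint_def comp_def
        encode_def[of "encode \<beta>"])
qed

lemma step_cases:
  assumes T: "represents T B1"
  shows "(step (Node (encode_state T) r) = Node (encode_state T) r \<and> (\<nexists>B2. removal k ord \<sigma> A B1 B2)) \<or>
    (\<exists>T' B2. step (Node (encode_state T) r) = Node (encode_state T') (Node (encode_state T) r) \<and>
      removal k ord \<sigma> A B1 B2 \<and> represents T' B2)"
proof (cases "inconsistent (list_of_tree (encode_state T))")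
  case Nil
  have "\<not> removal k ord \<sigma> A B1 B2" for B2
  proof
    assume "removal k ord \<sigma> A B1 B2"
    then obtain U bs where U: "k_union k \<sigma> A U" "bs \<in> rel B1 U" "\<not> projective_hom \<sigma>' A' B1 (tup U bs)"
      using removal_cases by metis
    then obtain u where "u \<in> set us" "U = set u" using us(1) by blast
    then show False
      using inconsistent[OF T] Nil U T unfolding represents_def by auto
  qed
  then show ?thesis using Nil by (simp add: step_def)
next
  case (Cons b bs)
  then have "b \<in> set (inconsistent (list_of_tree (encode_state T)))" by simp
  then obtain u t where b: "b = Node (encode \<alpha> u) (encode \<beta> t)" and u: "u \<in> set us" "t \<in> set (T u)"
      and np: "\<not> projective_hom \<sigma>' A' B1 (tup (set u) t)"
    unfolding inconsistent[OF T] by blast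
  define T' where "T' = (\<lambda>v. filter (\<lambda>t'. \<not> (v = u \<and> t' = t)) (T v))"
  define B2 where "B2 = B1\<lparr>rel := (rel B1)(set u := rel B1 (set u) - {t})\<rparr>"
  have "step (Node (encode_state T) r) = Node (encode_state T') (Node (encode_state T) r)"
    using Cons delete[OF T u] by (simp add: step_def b T'_def)
  moreover have rem: "removal k ord \<sigma> A B1 B2"
    unfolding removal_def B2_def using np represents_mem(1)[OF T u] k_union_us[OF u(1)]
    by (auto simp: tup_def)
  moreover have "represents T' B2"
    unfolding represents_def
  proof (intro conjI ballI)
    show "subtarget B2" using subtarget_removal[OF _ rem] T by (simp add: represents_def)
    fix v
    assume v: "v \<in> set us"
    show "distinct (T' v)" using T v by (simp add: T'_def represents_def)
    \<comment> \<open>\<open>removal\<close> changes the relation at the set, the program at the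
      listing; these coincide because each set has just one listing in \<open>us\<close>.\<close>
    have "set v = set u \<longleftrightarrow> v = u"
      using us(2) u(1) v by (auto simp: distinct_map inj_on_def)
    then show "set (T' v) = rel B2 (set v)"
      using T v by (auto simp: T'_def B2_def represents_def)
  qed
  ultimately show ?thesis by blast
qed

text \<open>The final disjunction covers both phases of the loop: either every round so far has
  removed a tuple, giving one structure more than rounds, or a fixed point was reached and later
  rounds idle.\<close>

lemma steps:
  "\<exists>Ts Bs. foldl (\<lambda>acc h. step acc) (Node (tree_of_list (initial k x)) Leaf) ys = encode encode_state (rev Ts) \<and>
    execution k ord \<sigma> A B Bs \<and> list_all2 represents Ts Bs \<and>
    (length Bs = Suc (length ys) \<or> complete_execution k ord \<sigma> A B Bs)"
proof (induction ys rule: rev_induct)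
  case Nil
  show ?case
    using initial
    by (intro exI[of _ "[tuples\<^sub>0]"] exI[of _ "[B\<^sub>0]"]) (auto simp: encode_def execution_def)
next
  case (snoc y ys)
  then obtain Ts Bs where IH:
    "foldl (\<lambda>acc h. step acc) (Node (tree_of_list (initial k x)) Leaf) ys = encode encode_state (rev Ts)"
    "execution k ord \<sigma> A B Bs" "list_all2 represents Ts Bs"
    "length Bs = Suc (length ys) \<or> complete_execution k ord \<sigma> A B Bs"
    by blast
  have Bs: "Bs \<noteq> []" using IH(2) by (simp add: execution_def)
  then have Ts: "Ts \<noteq> []" using IH(3) by auto
  have last: "represents (last Ts) (last Bs)"
    using IH(3) Bs Ts by (metis list_all2_conv_all_nth last_conv_nth diff_less length_greater_0_conv zero_less_one)
  have enc: "encode encode_state (rev Ts) =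
      Node (encode_state (last Ts)) (encode encode_state (rev (butlast Ts)))"
    using Ts by (cases Ts rule: rev_cases) (auto simp: encode_def)
  have fold: "foldl (\<lambda>acc h. step acc) (Node (tree_of_list (initial k x)) Leaf) (ys @ [y]) =
      step (encode encode_state (rev Ts))"
    using IH(1) by simp
  from step_cases[OF last, of "encode encode_state (rev (butlast Ts))"] show ?case
  proof (elim disjE conjE exE)
    assume "step (Node (encode_state (last Ts)) (encode encode_state (rev (butlast Ts)))) =
        Node (encode_state (last Ts)) (encode encode_state (rev (butlast Ts)))"
      "\<nexists>B2. removal k ord \<sigma> A (last Bs) B2"
    then show ?thesis
      using IH(2,3) fold enc unfolding complete_execution_def by metis
  next
    fix T' B2
    assume st: "step (Node (encode_state (last Ts)) (encode encode_state (rev (butlast Ts)))) =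
        Node (encode_state T') (Node (encode_state (last Ts)) (encode encode_state (rev (butlast Ts))))"
      and rem: "removal k ord \<sigma> A (last Bs) B2" and rep: "represents T' B2"
    \<comment> \<open>A removal is still possible, so the execution was not complete and no round
      has idled yet.\<close>
    have len: "length Bs = Suc (length ys)"
      using IH(4) rem unfolding complete_execution_def by blast
    show ?thesis
    proof (intro exI conjI)
      show "foldl (\<lambda>acc h. step acc) (Node (tree_of_list (initial k x)) Leaf) (ys @ [y]) =
          encode encode_state (rev (Ts @ [T']))"
        unfolding fold enc st by (simp add: enc[symmetric]) (simp add: encode_def)
      show "execution k ord \<sigma> A B (Bs @ [B2])"
        using IH(2) rem Bs by (simp add: execution_def successively_append_iff)
      show "list_all2 represents (Ts @ [T']) (Bs @ [B2])"
        using IH(3) rep by (simp add: list_all2_appendI)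
      show "length (Bs @ [B2]) = Suc (length (ys @ [y])) \<or> complete_execution k ord \<sigma> A B (Bs @ [B2])"
        using len by simp
    qed
  qed
qed

text \<open>An execution that could still be continued would be too long.\<close>

lemma run:
  obtains Ts Bs where "run k x = encode encode_state (rev Ts)" "complete_execution k ord \<sigma> A B Bs"
    "list_all2 represents Ts Bs"
proof -
  obtain Ts Bs where TB: "run k x = encode encode_state (rev Ts)" "execution k ord \<sigma> A B Bs"
    "list_all2 represents Ts Bs" "length Bs = Suc (length Ls) \<or> complete_execution k ord \<sigma> A B Bs"
    using steps[of "assignments k x"] unfolding run_def assignments by auto
  have "complete_execution k ord \<sigma> A B Bs"
  proof (rule ccontr)
    assume nc: "\<not> complete_execution k ord \<sigma> A B Bs"
    then obtain B2 where "removal k ord \<sigma> A (last Bs) B2"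
      using TB(2) unfolding complete_execution_def by blast
    then have "execution k ord \<sigma> A B (Bs @ [B2])"
      using TB(2) by (simp add: execution_def successively_append_iff)
    \<comment> \<open>\<open>length Ls\<close> rounds without idling produce
      \<open>Suc (length Ls)\<close> structures, which already meets the bound; one more exceeds it,
      so the counter is just long enough.\<close>
    then have "length (Bs @ [B2]) \<le> Suc (length Ls)"
      by (rule length_execution[OF listing_ord])
    then show False using TB(4) nc by simp
  qed
  then show thesis using that TB by blast
qed

lemma instance_tree:
  assumes T: "represents T B1"
  shows "instance_code (set_code (name_code \<alpha>)) (name_code \<alpha>) (name_code \<beta>) \<sigma>' A' B1
    (instance_tree x (encode_state T))"
proof -
  let ?row = "\<lambda>u. tree_of_list [encode \<alpha> u, unary (length u), encode (encode \<alpha>) [u], encode (encode \<beta>) (T u)]"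
  have "instance_tree x (encode_state T) = tree_of_list [encode \<alpha> as\<^sub>A, encode \<beta> bs\<^sub>B, encode ?row us]"
    by (simp add: instance_tree_def x encode_state_def encode_constraint_def encode_def[of ?row]
        unary_def comp_def map_replicate_const) (simp add: encode_def)
  moreover have "set_code (name_code \<alpha>) (universe A') (encode \<alpha> as\<^sub>A)"
    using universes by (auto simp: set_code_def list_code_name union_source_def)
  moreover have "set_code (name_code \<beta>) (universe B1) (encode \<beta> bs\<^sub>B)"
    using universes T by (auto simp: set_code_def list_code_name represents_def subtarget_def)
  moreover have "set_code (\<lambda>R t. \<exists>n a b. set_code (name_code \<alpha>) R n \<and>
        set_code (list_code (name_code \<alpha>)) (rel A' R) a \<and>
        set_code (list_code (name_code \<beta>)) (rel B1 R) b \<and>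
        t = tree_of_list [n, unary (arity \<sigma>' R), a, b]) (symbols \<sigma>') (encode ?row us)"
    (is "set_code ?code _ _")
  proof -
    have "?code (set u) (?row u)" if u: "u \<in> set us" for u
    proof (intro exI conjI)
      show "set_code (name_code \<alpha>) (set u) (encode \<alpha> u)"
        using us(3)[OF u] by (auto simp: set_code_def list_code_name)
      have "rel A' (set u) = {u}"
        using k_union_us[OF u] ord_set[OF u] by (simp add: union_source_def)
      then show "set_code (list_code (name_code \<alpha>)) (rel A' (set u)) (encode (encode \<alpha>) [u])"
        unfolding set_code_def list_code_list_code_name by (intro exI[of _ "[u]"]) simp
      show "set_code (list_code (name_code \<beta>)) (rel B1 (set u)) (encode (encode \<beta>) (T u))"
        using T u by (auto simp: set_code_def list_code_list_code_name represents_def)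
      show "?row u = tree_of_list [encode \<alpha> u, unary (arity \<sigma>' (set u)), encode (encode \<alpha>) [u],
          encode (encode \<beta>) (T u)]"
        using us(3)[OF u] by (simp add: union_signature_def distinct_card)
    qed
    then have "list_all2 ?code (map set us) (map ?row us)"
      by (simp add: list_all2_conv_all_nth)
    then have "list_code ?code (map set us) (encode ?row us)"
      unfolding list_code_def encode_def by blast
    moreover have "set (map set us) = symbols \<sigma>'"
      using us(1) by (simp add: union_signature_def)
    ultimately show ?thesis
      using us(2) unfolding set_code_def by blast
  qed
  ultimately show ?thesis
    unfolding instance_code_def by blast
qed

lemma trace:
  "\<exists>Bs. complete_execution k ord \<sigma> A B Bs \<and> execution_code \<alpha> \<beta> k ord \<sigma> A Bs (trace k x)"
proof -
  obtain Ts Bs where TB: "run k x = encode encode_state (rev Ts)" "complete_execution k ord \<sigma> A B Bs"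
    "list_all2 represents Ts Bs"
    using run .
  have Bs: "Bs \<noteq> []" using TB(2) by (simp add: complete_execution_def execution_def)
  then have Ts: "Ts \<noteq> []" using TB(3) by auto
  have last: "represents (last Ts) (last Bs)"
    using TB(3) Bs Ts by (metis list_all2_conv_all_nth last_conv_nth diff_less length_greater_0_conv zero_less_one)
  \<comment> \<open>The newest state heads the history, so the report computed from it concerns the
    last structure.\<close>
  have "left (run k x) = encode_state (last Ts)"
    using Ts unfolding TB(1) by (cases Ts rule: rev_cases) (auto simp: encode_def)
  then have "(\<forall>p\<in>set (list_of_tree (left (run k x))). right p = Leaf) \<longleftrightarrow> (\<forall>u\<in>set us. last Ts u = [])"
    by (auto simp: encode_state_def encode_constraint_def encode_def[of "encode \<beta>"])
  also have "\<dots> \<longleftrightarrow> (\<forall>U\<in>set ` set us. rel (last Bs) U = {})"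
    using last by (auto simp: represents_def)
  also have "\<dots> \<longleftrightarrow> reports_inconsistency k \<sigma> A (last Bs)"
    unfolding us(1) reports_inconsistency_def by blast
  finally have rep: "(\<forall>p\<in>set (list_of_tree (left (run k x))). right p = Leaf) \<longleftrightarrow>
      reports_inconsistency k \<sigma> A (last Bs)" .
  let ?code = "instance_code (set_code (name_code \<alpha>)) (name_code \<alpha>) (name_code \<beta>) \<sigma>' A'"
  have "map (instance_tree x) (rev (list_of_tree (run k x))) = map (\<lambda>T. instance_tree x (encode_state T)) Ts"
    unfolding TB(1) by (simp add: rev_map)
  moreover have "list_all2 ?code Bs (map (\<lambda>T. instance_tree x (encode_state T)) Ts)"
    using TB(3) instance_tree by (auto simp: list_all2_conv_all_nth)
  ultimately have "list_code ?code Bs (tree_of_list (map (instance_tree x) (rev (list_of_tree (run k x)))))"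
    unfolding list_code_def by auto
  then have "execution_code \<alpha> \<beta> k ord \<sigma> A Bs (trace k x)"
    unfolding execution_code_def trace_def using rep by auto
  then show ?thesis using TB(2) by blast
qed

end

section \<open>Decoding the input and the polynomial bound\<close>

lemma encoded_instanceI:
  assumes "csp_instance \<sigma> A B" "inj_on \<alpha> (universe A)" "inj_on \<beta> (universe B)"
    "instance_code (name_code \<gamma>) (name_code \<alpha>) (name_code \<beta>) \<sigma> A B x"
  shows "\<exists>as\<^sub>A bs\<^sub>B Rs rel\<^sub>A rel\<^sub>B. encoded_instance \<sigma> A B \<gamma> \<alpha> \<beta> x as\<^sub>A bs\<^sub>B Rs rel\<^sub>A rel\<^sub>B"
proof -
  let ?code = "\<lambda>R t. \<exists>n a b. name_code \<gamma> R n \<and> set_code (list_code (name_code \<alpha>)) (rel A R) a \<and>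
      set_code (list_code (name_code \<beta>)) (rel B R) b \<and> t = tree_of_list [n, unary (arity \<sigma> R), a, b]"
  obtain tA tB tR where t: "set_code (name_code \<alpha>) (universe A) tA" "set_code (name_code \<beta>) (universe B) tB"
      "set_code ?code (symbols \<sigma>) tR" "x = tree_of_list [tA, tB, tR]"
    using assms(4) unfolding instance_code_def by blast
  obtain as\<^sub>A where a: "distinct as\<^sub>A" "set as\<^sub>A = universe A" "tA = encode \<alpha> as\<^sub>A"
    using t(1) by (auto simp: set_code_def list_code_name)
  obtain bs\<^sub>B where b: "distinct bs\<^sub>B" "set bs\<^sub>B = universe B" "tB = encode \<beta> bs\<^sub>B"
    using t(2) by (auto simp: set_code_def list_code_name)
  obtain Rs where Rs: "distinct Rs" "set Rs = symbols \<sigma>" "list_code ?code Rs tR"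
    using t(3) unfolding set_code_def by blast
  obtain f where f: "tR = encode f Rs" "\<forall>R\<in>set Rs. ?code R (f R)"
    using list_code_distinct[OF Rs(3,1)] by blast
  have "\<forall>R\<in>set Rs. \<exists>p q. set p = rel A R \<and> set q = rel B R \<and>
      f R = tree_of_list [\<gamma> R, unary (arity \<sigma> R), encode (encode \<alpha>) p, encode (encode \<beta>) q]"
    using f(2) unfolding set_code_def list_code_list_code_name name_code_def by blast
  then obtain p q where pq: "\<And>R. R \<in> set Rs \<Longrightarrow> set (p R) = rel A R \<and> set (q R) = rel B R \<and>
      f R = tree_of_list [\<gamma> R, unary (arity \<sigma> R), encode (encode \<alpha>) (p R), encode (encode \<beta>) (q R)]"
    by metis
  have "tR = encode (\<lambda>R. tree_of_list
      [\<gamma> R, unary (arity \<sigma> R), encode (encode \<alpha>) (p R), encode (encode \<beta>) (q R)]) Rs"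
    using pq unfolding f(1) encode_def[of _ Rs] by (metis (no_types, lifting) map_cong)
  then have "encoded_instance \<sigma> A B \<gamma> \<alpha> \<beta> x as\<^sub>A bs\<^sub>B Rs p q"
    using assms a b Rs(2) pq t(4) by unfold_locales auto
  then show ?thesis by blast
qed

lemma polynomial_time: "runs_in_polynomial_time TYPE('s) TYPE('a) TYPE('b) k"
proof -
  obtain P e p where prog: "realizes P e p (trace k)"
    using fpt_trace fpt_iff by blast
  obtain q where q: "\<And>x. size (tree_of_list (assignments k x)) \<le> poly q (size x)"
    using fpt_size[OF fpt_tree_of_list[OF fptl_assignments[OF fpt_id, of k]]] by metis
  \<comment> \<open>The main function must have index 0, so the expression becomes the first body
    and all calls move by 1.\<close>
  let ?P = "shift 1 e # map (shift 1) P"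
  \<comment> \<open>\<open>p\<close> bounds the time of the body and \<open>q\<close> the number of
    rounds. The constant 2 pays for the main call with its argument, and in the bound on
    \<open>length Bs\<close> for the initial structure.\<close>
  let ?p = "p + q + [:2:]"
  have P: "realizes ?P (shift 1 e) p (trace k)"
    using realizes_shift[OF prog, of "[shift 1 e]"] by simp
  have time: "\<exists>t \<le> poly ?p (size x). computes_in_time ?P x (trace k x) t" for x
  proof -
    obtain t where t: "t \<le> poly p (size x)" "eval ?P [x] (shift 1 e) (trace k x) t"
      using realizes_eval[OF P] .
    have "evals ?P [x] [Param 0] [x] (1 + 0)"
      by (intro evals_Cons evals_Nil eval_Param0)
    then have "eval ?P [x] (Call 0 [Param 0]) (trace k x) (1 + 0 + t + 1)"
      using t(2) by (intro eval_Call) auto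
    moreover have "1 + 0 + t + 1 \<le> poly ?p (size x)" using t(1) by simp
    ultimately show ?thesis unfolding computes_in_time_def by blast
  qed
  show ?thesis
    unfolding runs_in_polynomial_time_def
  proof (rule exI[of _ ?P], rule exI[of _ ?p], intro allI impI conjI)
    fix \<sigma> :: "'s rel_signature" and A :: "('s, 'a) rel_struct" and B :: "('s, 'b) rel_struct"
      and \<gamma> \<alpha> \<beta> x ord Bs
    assume inst: "csp_instance \<sigma> A B \<and> inj_on \<gamma> (symbols \<sigma>) \<and> inj_on \<alpha> (universe A) \<and>
      inj_on \<beta> (universe B) \<and> instance_code (name_code \<gamma>) (name_code \<alpha>) (name_code \<beta>) \<sigma> A B x"
      and ex: "listing k \<sigma> A ord \<and> execution k ord \<sigma> A B Bs"
    obtain as\<^sub>A bs\<^sub>B Rs rel\<^sub>A rel\<^sub>B where "encoded_instance \<sigma> A B \<gamma> \<alpha> \<beta> x as\<^sub>A bs\<^sub>B Rs rel\<^sub>A rel\<^sub>B"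
      using encoded_instanceI inst by blast
    then interpret encoded_instance \<sigma> A B k \<gamma> \<alpha> \<beta> x as\<^sub>A bs\<^sub>B Rs rel\<^sub>A rel\<^sub>B .
    have "length Bs \<le> Suc (length Ls)" using length_execution ex by blast
    also have "length Ls = length (assignments k x)" by (simp add: assignments)
    also have "\<dots> \<le> poly q (size x)"
      using length_le_size q by (rule order_trans)
    finally show "length Bs \<le> poly ?p (size x)" by simp
  next
    fix \<sigma> :: "'s rel_signature" and A :: "('s, 'a) rel_struct" and B :: "('s, 'b) rel_struct"
      and \<gamma> \<alpha> \<beta> x
    assume inst: "csp_instance \<sigma> A B \<and> inj_on \<gamma> (symbols \<sigma>) \<and> inj_on \<alpha> (universe A) \<and>
      inj_on \<beta> (universe B) \<and> instance_code (name_code \<gamma>) (name_code \<alpha>) (name_code \<beta>) \<sigma> A B x"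
    obtain as\<^sub>A bs\<^sub>B Rs rel\<^sub>A rel\<^sub>B where "encoded_instance \<sigma> A B \<gamma> \<alpha> \<beta> x as\<^sub>A bs\<^sub>B Rs rel\<^sub>A rel\<^sub>B"
      using encoded_instanceI inst by blast
    then interpret encoded_instance \<sigma> A B k \<gamma> \<alpha> \<beta> x as\<^sub>A bs\<^sub>B Rs rel\<^sub>A rel\<^sub>B .
    show "\<exists>ord Bs y t. listing k \<sigma> A ord \<and> complete_execution k ord \<sigma> A B Bs \<and>
        execution_code \<alpha> \<beta> k ord \<sigma> A Bs y \<and> computes_in_time ?P x y t \<and> t \<le> poly ?p (size x)"
      using trace listing_ord time by blast
  qed
qed

theorem theorem5:
  fixes k :: nat
  assumes "k \<ge> 1"
  shows "runs_in_polynomial_time TYPE('s) TYPE('a) TYPE('b) k \<and>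
    (\<forall>(\<sigma> :: 's rel_signature) (A :: ('s, 'a) rel_struct) (B :: ('s, 'b) rel_struct) ord Bs.
       csp_instance \<sigma> A B \<and> listing k \<sigma> A ord \<and> complete_execution k ord \<sigma> A B Bs \<longrightarrow>
       (let \<sigma>' = union_signature k \<sigma> A; A' = union_source k ord \<sigma> A; B' = last Bs in
         csp_instance \<sigma>' A' B' \<and>
         satisfying_assignments \<sigma>' A' B' = satisfying_assignments \<sigma> A B \<and>
         (\<Union>(hyperedges \<sigma> A) \<noteq> {} \<longrightarrow>
           (reports_inconsistency k \<sigma> A B' \<longleftrightarrow> \<not> (\<exists>H. winning_strategy k \<sigma> A B H)))))"
proof (intro conjI allI impI polynomial_time)
  fix \<sigma> :: "'s rel_signature" and A :: "('s, 'a) rel_struct" and B :: "('s, 'b) rel_struct" and ord Bs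
  assume *: "csp_instance \<sigma> A B \<and> listing k \<sigma> A ord \<and> complete_execution k ord \<sigma> A B Bs"
  then interpret algorithm \<sigma> A B k ord
    by unfold_locales auto
  show "let \<sigma>' = union_signature k \<sigma> A; A' = union_source k ord \<sigma> A; B' = last Bs in
         csp_instance \<sigma>' A' B' \<and>
         satisfying_assignments \<sigma>' A' B' = satisfying_assignments \<sigma> A B \<and>
         (\<Union>(hyperedges \<sigma> A) \<noteq> {} \<longrightarrow>
           (reports_inconsistency k \<sigma> A B' \<longleftrightarrow> \<not> (\<exists>H. winning_strategy k \<sigma> A B H)))"
    unfolding Let_def using output_correct[OF _ assms] * by blast
qed

end
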